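(* Let $0<p<\infty$, $n$ a positive integer, $F\in H(\mathbb{D})$ with $I^nF\in A^p$, and $g_k\in\mathcal{B}^{0,n-k}$ for all $0\leq k\leq n-1$. Then there exists $A>0$, depending only on $p$, such that whenever $\|g_k\|_{0,n-k}<A$ for all $0\le k\le n-1$, every analytic solution $f$ on $\mathbb{D}$ of $$f^{(n)}+g_{n-1}(z)f^{(n-1)}+\cdots+g_0(z)f=F(z)$$ belongs to $A^p$. Furthermore, if $g_k\in\mathcal{B}_0^{0,n-k}$ for all $0\leq k\leq n-1$, then every such solution belongs to $A^p$ without any restriction on the norms $\|g_k\|_{0,n-k}$.
   Context: $\mathbb{D}$ is the open unit disc, $H(\mathbb{D})$ the analytic functions on $\mathbb{D}$, $dA=\frac{dx\,dy}{\pi}$, and $A^p=\{f\in H(\mathbb{D}):\int_{\mathbb{D}}|f|^p\,dA<\infty\}$. $I$ is the integration operator $(If)(z)=\int_0^zf(w)\,dw$ and $I^n$ its $n$-th iterate. For $\alpha>0$, $\mathcal{B}^{0,\alpha}=\{g\in H(\mathbb{D}):\|g\|_{0,\alpha}=\sup_{z\in\mathbb{D}}|g(z)|(1-|z|^2)^\alpha<\infty\}$ and $\mathcal{B}_0^{0,\alpha}=\{g\in H(\mathbb{D}):\lim_{|z|\to1^-}|g(z)|(1-|z|^2)^\alpha=0\}$. *)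

theory Defs
  imports "HOL-Complex_Analysis.Complex_Analysis"
begin

abbreviation unit_disc :: "complex set" where
  "unit_disc \<equiv> ball 0 1"

definition intop :: "(complex \<Rightarrow> complex) \<Rightarrow> complex \<Rightarrow> complex" where
  "intop f z = contour_integral (linepath 0 z) f"

text \<open>Bergman space A^p: analytic on the disc with finite p-th area integral.
  The normalisation dA = dx dy / pi does not affect finiteness.\<close>
definition bergman :: "real \<Rightarrow> (complex \<Rightarrow> complex) set" where
  "bergman p = {f. f holomorphic_on unit_disc \<and>
      (\<integral>\<^sup>+ z. indicator unit_disc z * ennreal (norm (f z) powr p) \<partial>lborel) < \<infinity>}"

definition growth_space :: "real \<Rightarrow> (complex \<Rightarrow> complex) set" where
  "growth_space \<alpha> = {g. g holomorphic_on unit_disc \<and>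
      (\<exists>C. \<forall>z\<in>unit_disc. norm (g z) * (1 - (norm z)\<^sup>2) powr \<alpha> \<le> C)}"

definition growth_norm :: "real \<Rightarrow> (complex \<Rightarrow> complex) \<Rightarrow> real" where
  "growth_norm \<alpha> g = (SUP z\<in>unit_disc. norm (g z) * (1 - (norm z)\<^sup>2) powr \<alpha>)"

definition little_growth_space :: "real \<Rightarrow> (complex \<Rightarrow> complex) set" where
  "little_growth_space \<alpha> = {g. g holomorphic_on unit_disc \<and>
      (\<forall>\<epsilon>>0. \<exists>r<1. \<forall>z. r < norm z \<and> norm z < 1 \<longrightarrow>
          norm (g z) * (1 - (norm z)\<^sup>2) powr \<alpha> \<le> \<epsilon>)}"

definition is_solution :: "nat \<Rightarrow> (nat \<Rightarrow> complex \<Rightarrow> complex) \<Rightarrow> (complex \<Rightarrow> complex)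
    \<Rightarrow> (complex \<Rightarrow> complex) \<Rightarrow> bool" where
  "is_solution n g F f \<longleftrightarrow> f holomorphic_on unit_disc \<and>
     (\<forall>z\<in>unit_disc. (deriv ^^ n) f z + (\<Sum>k<n. g k z * (deriv ^^ k) f z) = F z)"

end

theory Submission
  imports Defs
begin

text \<open>
  Put \<open>b = 1/(2p)\<close>. Along a radius the equation is compared with the powers
  \<open>(1-t)\<close> to the \<open>-(b+k)\<close>: since the sum of the Pochhammer symbols of \<open>b\<close> up to \<open>n-1\<close> is at most
  \<open>1/b\<close> times the \<open>n\<close>-th one, the threshold \<open>A = b/2 = 1/(4p)\<close> works for every order \<open>n\<close>.
  The outcome is \<open>|f(z)| \<le> C (1+\<Lambda>(z)) (1-|z|)^(-b)\<close>, where \<open>\<Lambda>(z)\<close> is the supremum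
  of \<open>|F(sz)| (1-s|z|)^(n+b)\<close> over \<open>0 \<le> s \<le> 1\<close>. Cauchy's estimate and the sub-mean value property of
  \<open>|G|^p\<close> for \<open>G = I^n F\<close> bound \<open>\<Lambda>(z)^p\<close> by the integral of \<open>|G(\<zeta>)|^p (1-|\<zeta>|)^(-3/2)\<close> over
  the \<open>\<zeta>\<close> with \<open>|z-\<zeta>| \<le> 3(1-|\<zeta>|)\<close>. As \<open>bp = 1/2\<close>, Fubini reduces the claim to the integral of
  \<open>(1-|z|)^(-1/2)\<close> over a Carleson box of size \<open>d\<close>, which is \<open>O(d^(3/2))\<close>. Only the behaviour of the
  \<open>g_k\<close> on an annulus \<open>\<rho> \<le> |z| < 1\<close> enters, so the little-o case follows as well.
\<close>

section \<open>The equation along a radius\<close>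

text \<open>Adding the next term to the sum raises the left side to at most
  \<open>(1 + b) * pochhammer b n\<close>, and \<open>1 + b \<le> b + n\<close> once
  \<open>n \<ge> 1\<close>, so the induction starts at 1, where equality holds. This makes the
  smallness threshold independent of the order \<open>n\<close>.\<close>

lemma sum_pochhammer_le:
  fixes b :: real
  assumes "0 < b" "n \<ge> 1"
  shows "b * (\<Sum>k<n. pochhammer b k) \<le> pochhammer b n"
  using \<open>n \<ge> 1\<close>
proof (induction n rule: dec_induct)
  case base
  then show ?case by simp
next
  case (step n)
  have "b * (\<Sum>k<Suc n. pochhammer b k) \<le> (1 + b) * pochhammer b n"
    using step.IH by (simp add: algebra_simps)
  also have "\<dots> \<le> (b + real n) * pochhammer b n"
    using step.hyps assms by (intro mult_right_mono) (auto intro: less_imp_le pochhammer_pos)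
  finally show ?case by (simp add: pochhammer_Suc mult.commute)
qed

text \<open>The bound on the derivative has the primitive \<open>M * (1 - x) powr (-a)\<close>. The
  mean value inequality compares increments, and the nonnegative value of the primitive at
  \<open>r\<close> is dropped.\<close>

lemma norm_le_of_deriv_powr:
  fixes f :: "real \<Rightarrow> 'a::real_normed_vector"
  assumes "0 < a" "0 \<le> M" "r \<le> t" "t < 1"
    and f': "\<And>x. r \<le> x \<Longrightarrow> x \<le> t \<Longrightarrow> (f has_vector_derivative f' x) (at x)"
    and bd: "\<And>x. r \<le> x \<Longrightarrow> x \<le> t \<Longrightarrow> norm (f' x) \<le> M * a * (1 - x) powr (-(a + 1))"
  shows "norm (f t) \<le> norm (f r) + M * (1 - t) powr (-a)"
proof (cases "r = t")
  case True
  then show ?thesis using assms(2) by simp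
next
  case False
  let ?F = "\<lambda>x. M * (1 - x) powr (-a)"
  have F': "(?F has_vector_derivative M * a * (1 - x) powr (-(a + 1))) (at x)" if "x \<le> t" for x
  proof -
    have "(?F has_real_derivative M * a * (1 - x) powr (-(a + 1))) (at x)"
      using that \<open>t < 1\<close> by (auto intro!: derivative_eq_intros simp: powr_diff powr_minus divide_simps)
    then show ?thesis by (simp add: has_real_derivative_iff_has_vector_derivative)
  qed
  have "norm (f t - f r) \<le> ?F t - ?F r"
  proof (rule differentiable_bound_general[where f'=f' and \<phi>'="\<lambda>x. M * a * (1 - x) powr (-(a + 1))"])
    show "r < t" using False assms by simp
    show "continuous_on {r..t} f"
      using f' by (meson atLeastAtMost_iff continuous_at_imp_continuous_on has_vector_derivative_continuous)
    show "continuous_on {r..t} ?F"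
      using F' by (meson atLeastAtMost_iff continuous_at_imp_continuous_on has_vector_derivative_continuous)
  qed (use f' F' bd in auto)
  moreover have "0 \<le> ?F r" using assms by simp
  ultimately show ?thesis
    using norm_triangle_sub[of "f t" "f r"] by linarith
qed

lemma one_le_powr_minus:
  fixes x a :: real
  assumes "0 \<le> x" "x < 1" "0 \<le> a"
  shows "1 \<le> (1 - x) powr (-a)"
  using assms by (simp add: powr_minus powr_le1 one_le_inverse_iff)

text \<open>\<open>\<phi> k\<close> stands for the \<open>k\<close>-th derivative along the ray in
  direction \<open>e\<close>, and the factor \<open>e\<close> comes from the chain rule. A bound
  with constant \<open>Q\<close> improves itself to one with constant \<open>B 0 + Q / 2\<close>,
  and iteration leads to the fixed point \<open>2 * B 0\<close>.\<close>

lemma radial_growth_bound: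
  fixes \<phi> :: "nat \<Rightarrow> real \<Rightarrow> complex"
  assumes b: "0 < b" and n: "n \<ge> 1" and rt: "0 \<le> r" "r \<le> t" "t < 1" and e: "norm e = 1"
    and Y: "0 \<le> Y" and \<Lambda>: "0 \<le> \<Lambda>"
    and deriv: "\<And>k x. k < n \<Longrightarrow> r \<le> x \<Longrightarrow> x \<le> t \<Longrightarrow>
                  (\<phi> k has_vector_derivative e * \<phi> (Suc k) x) (at x)"
    and init: "\<And>k. k < n \<Longrightarrow> norm (\<phi> k r) \<le> Y"
    and ode: "\<And>x. r \<le> x \<Longrightarrow> x \<le> t \<Longrightarrow> norm (\<phi> n x) \<le> \<Lambda> * (1 - x) powr (-(b + n))
                + (\<Sum>k<n. b / 2 * (1 - x) powr (- real (n - k)) * norm (\<phi> k x))"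
  shows "norm (\<phi> 0 t) \<le> 2 * (\<Lambda> / pochhammer b n + (\<Sum>k<n. Y / pochhammer b k)) * (1 - t) powr (-b)"
proof -
  define C where "C = pochhammer b"
  have C: "C k > 0" for k using b by (simp add: C_def pochhammer_pos)
  have C_Suc: "C (Suc k) = C k * (b + k)" for k by (simp add: C_def pochhammer_Suc mult.commute)
  \<comment> \<open>\<open>\<Lambda> / C n\<close> comes from the forcing term. Integration from
    order \<open>n\<close> down to order \<open>k\<close> picks up one initial value, normalised by
    \<open>C j\<close>, at each order \<open>j\<close> with \<open>k \<le> j < n\<close>.\<close>
  define B where "B k = \<Lambda> / C n + (\<Sum>j=k..<n. Y / C j)" for k
  define valid where "valid Q \<longleftrightarrow> (\<forall>k<n. \<forall>x\<in>{r..t}. norm (\<phi> k x) \<le> Q * C k * (1 - x) powr (-(b + k)))" for Q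
  have B0: "0 \<le> B k" for k
    unfolding B_def using \<Lambda> Y C by (intro add_nonneg_nonneg divide_nonneg_nonneg sum_nonneg) (auto intro: less_imp_le)
  \<comment> \<open>Inserting a bound into the equation and integrating down from order \<open>n\<close> halves its excess.\<close>
  have step: "valid (B 0 + Q / 2)" if v: "valid Q" and Q: "0 \<le> Q" for Q
  proof -
    have "\<forall>x\<in>{r..t}. norm (\<phi> k x) \<le> (B k + Q / 2) * C k * (1 - x) powr (-(b + k))" if "k \<le> n" for k
      using that
    proof (induction k rule: inc_induct)
      case base
      show ?case
      proof
        fix x assume x: "x \<in> {r..t}"
        have pw: "(1 - x) powr (- real (n - k)) * (1 - x) powr (-(b + k)) = (1 - x) powr (-(b + n))" if "k < n" for k
          using that x rt by (simp flip: powr_add add: of_nat_diff algebra_simps)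
        have "(\<Sum>k<n. b / 2 * (1 - x) powr (- real (n - k)) * norm (\<phi> k x))
            \<le> (\<Sum>k<n. b / 2 * Q * C k * (1 - x) powr (-(b + n)))"
        proof (rule sum_mono)
          fix k assume k: "k \<in> {..<n}"
          have "b / 2 * (1 - x) powr (- real (n - k)) * norm (\<phi> k x)
             \<le> b / 2 * (1 - x) powr (- real (n - k)) * (Q * C k * (1 - x) powr (-(b + k)))"
            using v k x b by (intro mult_left_mono) (auto simp: valid_def)
          also have "\<dots> = b / 2 * Q * C k * (1 - x) powr (-(b + n))"
            using pw[of k] k by (simp add: algebra_simps)
          finally show "b / 2 * (1 - x) powr (- real (n - k)) * norm (\<phi> k x)
             \<le> b / 2 * Q * C k * (1 - x) powr (-(b + n))" .
        qed
        also have "\<dots> = Q / 2 * (b * (\<Sum>k<n. C k)) * (1 - x) powr (-(b + n))"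
          by (simp add: sum_distrib_left sum_distrib_right algebra_simps)
        also have "\<dots> \<le> Q / 2 * C n * (1 - x) powr (-(b + n))"
          using sum_pochhammer_le[OF b n] Q unfolding C_def
          by (intro mult_right_mono mult_left_mono) auto
        finally have "norm (\<phi> n x) \<le> \<Lambda> * (1 - x) powr (-(b + n)) + Q / 2 * C n * (1 - x) powr (-(b + n))"
          using ode[of x] x by auto
        also have "\<dots> = (B n + Q / 2) * C n * (1 - x) powr (-(b + n))"
          using C[of n] by (simp add: B_def field_simps)
        finally show "norm (\<phi> n x) \<le> (B n + Q / 2) * C n * (1 - x) powr (-(b + n))" .
      qed
    next
      case (step k)
      show ?case
      proof
        fix x assume x: "x \<in> {r..t}"
        \<comment> \<open>Integrating divides by \<open>b + k\<close>, which is exactly the ratio of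
          \<open>C (Suc k)\<close> to \<open>C k\<close>. Hence the excess \<open>Q / 2\<close> is
          not amplified on the way down.\<close>
        have "norm (\<phi> k x) \<le> norm (\<phi> k r) + (B (Suc k) + Q / 2) * C k * (1 - x) powr (-(b + k))"
        proof (rule norm_le_of_deriv_powr)
          have ex: "- (b + real (Suc k)) = - (b + real k + 1)" by simp
          show "(\<phi> k has_vector_derivative e * \<phi> (Suc k) y) (at y)" if "r \<le> y" "y \<le> x" for y
            using deriv that x step.hyps by auto
          show "norm (e * \<phi> (Suc k) y) \<le> (B (Suc k) + Q / 2) * C k * (b + k) * (1 - y) powr (-(b + k + 1))"
            if "r \<le> y" "y \<le> x" for y
            using step.IH that x e unfolding ex C_Suc by (auto simp: norm_mult mult.assoc)
        qed (use x rt b B0 C[of k] Q in \<open>auto simp: less_imp_le\<close>)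
        also have "norm (\<phi> k r) \<le> Y / C k * C k * (1 - x) powr (-(b + k))"
        proof -
          have "1 \<le> (1 - x) powr (-(b + k))"
            using x rt b by (intro one_le_powr_minus) auto
          then have "Y * 1 \<le> Y * (1 - x) powr (-(b + k))"
            using Y by (intro mult_left_mono)
          then show ?thesis using init[of k] step.hyps C[of k] by simp
        qed
        finally show "norm (\<phi> k x) \<le> (B k + Q / 2) * C k * (1 - x) powr (-(b + k))"
          using step.hyps by (simp add: B_def sum.atLeast_Suc_lessThan algebra_simps)
      qed
    qed
    moreover have "B k \<le> B 0" for k
      unfolding B_def using Y C
      by (intro add_left_mono sum_mono2 divide_nonneg_nonneg) (auto intro: less_imp_le)
    then have "(B k + Q / 2) * C k * (1 - x) powr (-(b + k)) \<le> (B 0 + Q / 2) * C k * (1 - x) powr (-(b + k))"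
      for k x using C[of k] by (intro mult_right_mono) (auto intro: less_imp_le)
    ultimately show ?thesis
      unfolding valid_def by (meson order_trans less_imp_le)
  qed
  \<comment> \<open>Compactness of \<open>{r..t}\<close> provides a first admissible constant. It
    may depend on \<open>t\<close> without control, but its contribution is halved at each iteration
    and vanishes in the limit.\<close>
  have "\<exists>Q0\<ge>0. valid Q0"
  proof -
    have "\<exists>M\<ge>0. \<forall>x\<in>{r..t}. norm (\<phi> k x) \<le> M" if "k < n" for k
    proof -
      have "continuous_on {r..t} (\<phi> k)"
        using deriv[OF that] by (meson atLeastAtMost_iff continuous_at_imp_continuous_on has_vector_derivative_continuous)
      then have "bounded (\<phi> k ` {r..t})"
        by (intro compact_imp_bounded compact_continuous_image) auto
      then show ?thesis by (auto simp: bounded_pos intro: less_imp_le)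
    qed
    then obtain M where M: "\<And>k. k < n \<Longrightarrow> 0 \<le> M k" "\<And>k x. k < n \<Longrightarrow> x \<in> {r..t} \<Longrightarrow> norm (\<phi> k x) \<le> M k"
      by metis
    define Q0 where "Q0 = (\<Sum>k<n. M k / C k)"
    have "0 \<le> Q0" unfolding Q0_def using M C by (intro sum_nonneg) (auto intro!: divide_nonneg_nonneg less_imp_le[OF C])
    moreover have "norm (\<phi> k x) \<le> Q0 * C k * (1 - x) powr (-(b + k))" if "k < n" "x \<in> {r..t}" for k x
    proof -
      have "1 \<le> (1 - x) powr (-(b + k))"
        using that rt b by (intro one_le_powr_minus) auto
      moreover have "M k / C k \<le> Q0" unfolding Q0_def
        using M C that by (intro member_le_sum) (auto intro!: divide_nonneg_nonneg less_imp_le[OF C])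
      then have "M k \<le> Q0 * C k" using C[of k] by (simp add: divide_simps)
      moreover have "0 \<le> M k" using M that by simp
      ultimately have "M k * 1 \<le> Q0 * C k * (1 - x) powr (-(b + k))"
        by (intro mult_mono) auto
      with M(2)[OF that] show ?thesis by simp
    qed
    ultimately show ?thesis unfolding valid_def by blast
  qed
  then obtain Q0 where Q0: "0 \<le> Q0" "valid Q0" by blast
  \<comment> \<open>\<open>2 * B 0\<close> is the fixed point of the map from \<open>Q\<close> to
    \<open>B 0 + Q / 2\<close>; the distance to it halves at each step.\<close>
  have valid: "valid (2 * B 0 + Q0 / 2 ^ m)" for m
  proof (induction m)
    case 0
    have "Q0 * C k * (1 - x) powr (-(b + k)) \<le> (2 * B 0 + Q0) * C k * (1 - x) powr (-(b + k))" for k x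
      using B0[of 0] C[of k] by (intro mult_right_mono) (auto intro: less_imp_le)
    then show ?case
      using Q0(2) unfolding valid_def power_0 div_by_1 by (meson order_trans)
  next
    case (Suc m)
    show ?case using step[OF Suc] B0[of 0] Q0(1) by (simp add: field_simps)
  qed
  have "(\<lambda>m. (2 * B 0 + Q0 / 2 ^ m) * (1 - t) powr (-b)) \<longlonglongrightarrow> (2 * B 0 + 0) * (1 - t) powr (-b)"
    by (intro tendsto_intros LIMSEQ_divide_realpow_zero) auto
  moreover have "norm (\<phi> 0 t) \<le> (2 * B 0 + Q0 / 2 ^ m) * (1 - t) powr (-b)" for m
  proof -
    have "0 < n" "t \<in> {r..t}" using n rt by auto
    then have "norm (\<phi> 0 t) \<le> (2 * B 0 + Q0 / 2 ^ m) * C 0 * (1 - t) powr (-(b + real 0))"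
      using valid[of m] unfolding valid_def by blast
    then show ?thesis by (simp add: C_def)
  qed
  ultimately have "norm (\<phi> 0 t) \<le> (2 * B 0 + 0) * (1 - t) powr (-b)"
    by (intro LIMSEQ_le_const) auto
  then show ?thesis by (simp add: B_def C_def atLeast0LessThan)
qed

section \<open>Sub-mean value estimates over discs\<close>

text \<open>With \<open>c = 1\<close> this serves as translation invariance, with
  \<open>t = 0\<close> as the change of variables for a dilation.\<close>

lemma nn_integral_lborel_affine:
  fixes f :: "'a::euclidean_space \<Rightarrow> ennreal"
  assumes "f \<in> borel_measurable borel" "c \<noteq> 0"
  shows "(\<integral>\<^sup>+x. f x \<partial>lborel) = ennreal (\<bar>c\<bar> ^ DIM('a)) * (\<integral>\<^sup>+x. f (t + c *\<^sub>R x) \<partial>lborel)"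
  using assms by (subst lborel_affine[of c t])
    (auto simp: nn_integral_density nn_integral_distr nn_integral_cmult)

lemma emeasure_lborel_ball_complex:
  fixes c :: complex
  assumes "0 \<le> r"
  shows "emeasure lborel (ball c r) = ennreal (pi * r\<^sup>2)"
  using emeasure_ball[of r c] assms by (simp add: unit_ball_vol_2)

text \<open>Nothing is known about \<open>f\<close> outside \<open>S\<close>, so \<open>f\<close> is
  first cut off to zero there; on \<open>S\<close> the cut-off changes nothing.\<close>

lemma borel_measurable_powr_indicator:
  assumes f: "continuous_on S f" and S: "open S"
  shows "(\<lambda>z. ennreal (norm (f z) powr p) * indicator S z) \<in> borel_measurable borel"
proof -
  have [measurable]: "(\<lambda>z. indicator S z *\<^sub>R norm (f z)) \<in> borel_measurable borel"
    using assms by (intro borel_measurable_continuous_on_indicator continuous_intros) auto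
  have [measurable]: "(indicator S :: _ \<Rightarrow> ennreal) \<in> borel_measurable borel"
    using S by (intro borel_measurable_indicator) auto
  have "(\<lambda>z. ennreal ((indicator S z *\<^sub>R norm (f z)) powr p) * indicator S z) \<in> borel_measurable borel"
    by measurable
  also have "(\<lambda>z. ennreal ((indicator S z *\<^sub>R norm (f z)) powr p) * indicator S z)
      = (\<lambda>z. ennreal (norm (f z) powr p) * indicator S z)"
    by (auto simp: indicator_def)
  finally show ?thesis .
qed

text \<open>The point \<open>a\<close> need not be the centre of the circle. Since \<open>b\<close>
  is within \<open>R/4\<close> of \<open>a\<close>, the circle of radius \<open>R/2\<close> about
  \<open>b\<close> lies in the disc and keeps distance at least \<open>R/4\<close> from
  \<open>a\<close>, so the Cauchy kernel costs only the factor
  \<open>(R/2) / (R/4) = 2\<close>.\<close>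

lemma norm_le_circle_mean:
  assumes f: "f holomorphic_on ball a R" and b: "dist a b < R / 4"
  shows "ennreal (norm (f a)) \<le> 2 * (\<integral>\<^sup>+t. ennreal (norm (f (circlepath b (R/2) t))) * indicator {0..1} t \<partial>lborel)"
proof -
  let ?\<gamma> = "circlepath b (R/2)"
  have R: "0 < R" using b zero_le_dist[of a b] by linarith
  have sub: "cball b (R/2) \<subseteq> ball a R"
  proof
    fix z assume "z \<in> cball b (R/2)"
    then show "z \<in> ball a R" using b R dist_triangle[of a z b] by auto
  qed
  have cont: "continuous_on (cball b (R/2)) f"
    using f sub by (meson holomorphic_on_imp_continuous_on holomorphic_on_subset)
  have \<gamma>: "?\<gamma> t \<in> sphere b (R/2)" for t
    using R by (simp add: circlepath dist_norm norm_mult)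
  have cont\<gamma>: "continuous_on {0..1} (\<lambda>t. f (?\<gamma> t))"
    using \<gamma> by (intro continuous_on_compose2[OF cont]) (auto simp: circlepath intro!: continuous_intros)
  have "((\<lambda>u. f u / (u - a)) has_contour_integral (2 * of_real pi * \<i> * f a)) ?\<gamma>"
  proof (rule Cauchy_integral_circlepath[OF cont])
    show "f holomorphic_on ball b (R/2)"
      using sub ball_subset_cball by (intro holomorphic_on_subset[OF f]) blast
    show "norm (a - b) < R / 2" using b R by (simp add: dist_norm)
  qed
  then have I: "((\<lambda>t. f (?\<gamma> t) / (?\<gamma> t - a) * vector_derivative ?\<gamma> (at t within {0..1})) has_integral
      2 * of_real pi * \<i> * f a) {0..1}"
    by (simp only: has_contour_integral_def)
  have J: "(\<lambda>t. 4 * pi * norm (f (?\<gamma> t))) integrable_on {0..1}"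
    by (intro integrable_continuous_real continuous_intros cont\<gamma>)
  have "norm (2 * of_real pi * \<i> * f a) \<le> integral {0..1} (\<lambda>t. 4 * pi * norm (f (?\<gamma> t)))"
    unfolding integral_unique[OF I, symmetric]
  proof (rule integral_norm_bound_integral)
    fix t :: real assume t: "t \<in> {0..1}"
    have "dist a (?\<gamma> t) \<ge> R / 4" using \<gamma>[of t] b dist_triangle[of b "?\<gamma> t" a] by (auto simp: dist_commute)
    \<comment> \<open>\<open>pi * R\<close> is the speed of the circle of radius \<open>R/2\<close>
      parametrised over the unit interval.\<close>
    then have "norm (f (?\<gamma> t)) * (pi * R) / norm (?\<gamma> t - a) \<le> norm (f (?\<gamma> t)) * (pi * R) / (R / 4)"
      using R by (intro divide_left_mono mult_nonneg_nonneg mult_pos_pos) (auto simp: dist_norm norm_minus_commute)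
    then show "norm (f (?\<gamma> t) / (?\<gamma> t - a) * vector_derivative ?\<gamma> (at t within {0..1})) \<le> 4 * pi * norm (f (?\<gamma> t))"
      using t R by (simp add: vector_derivative_circlepath01 norm_mult norm_divide field_simps)
  qed (use I J in auto)
  also have "\<dots> = 4 * pi * integral {0..1} (\<lambda>t. norm (f (?\<gamma> t)))" by simp
  finally have "norm (f a) \<le> 2 * integral {0..1} (\<lambda>t. norm (f (?\<gamma> t)))"
    by (simp add: norm_mult)
  moreover have "(\<integral>\<^sup>+t. ennreal (norm (f (?\<gamma> t)) * indicator {0..1} t) \<partial>lborel) = ennreal (integral {0..1} (\<lambda>t. norm (f (?\<gamma> t))))"
  proof (rule nn_integral_has_integral_lborel)
    have "(\<lambda>t. indicator {0..1} t *\<^sub>R norm (f (?\<gamma> t))) \<in> borel_measurable borel"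
      by (intro borel_measurable_continuous_on_indicator continuous_intros cont\<gamma>) auto
    then show "(\<lambda>t. norm (f (?\<gamma> t)) * indicator {0..1} t) \<in> borel_measurable borel" by (simp add: mult.commute)
    have "((\<lambda>t. norm (f (?\<gamma> t))) has_integral integral {0..1} (\<lambda>t. norm (f (?\<gamma> t)))) {0..1}"
      by (intro integrable_integral integrable_continuous_real continuous_intros cont\<gamma>)
    then have "((\<lambda>t. if t \<in> {0..1} then norm (f (?\<gamma> t)) else 0) has_integral integral {0..1} (\<lambda>t. norm (f (?\<gamma> t)))) UNIV"
      by (simp only: has_integral_restrict_UNIV)
    then show "((\<lambda>t. norm (f (?\<gamma> t)) * indicator {0..1} t) has_integral integral {0..1} (\<lambda>t. norm (f (?\<gamma> t)))) UNIV"
      by (rule has_integral_eq[rotated]) (auto simp: indicator_def)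
  qed auto
  ultimately show ?thesis
    by (auto simp: ennreal_mult'' ennreal_indicator simp flip: ennreal_numeral ennreal_mult' intro!: ennreal_leI)
qed

text \<open>Averaging over the centre \<open>b\<close> of the circle, instead of its radius, needs only translation
  invariance of Lebesgue measure and no polar coordinates.\<close>
lemma norm_le_area_integral:
  assumes f: "f holomorphic_on ball a R" and R: "0 < R"
  shows "ennreal (norm (f a) * R\<^sup>2) \<le> 32 * (\<integral>\<^sup>+z. ennreal (norm (f z)) * indicator (ball a R) z \<partial>lborel)"
proof -
  define w where "w z = ennreal (norm (f z)) * indicator (ball a R) z" for z
  \<comment> \<open>\<open>c t\<close> is the displacement from the centre to the point of the
    circle at parameter \<open>t\<close>; it does not depend on the centre \<open>b\<close>.\<close>
  define c where "c t = complex_of_real (R/2) * exp (2 * of_real pi * \<i> * of_real t)" for t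
  define J where "J = (\<integral>\<^sup>+z. w z \<partial>lborel)"
  have w[measurable]: "w \<in> borel_measurable borel"
    unfolding w_def using borel_measurable_powr_indicator[of "ball a R" f 1] f
    by (simp add: holomorphic_on_imp_continuous_on)
  have c[measurable]: "c \<in> borel_measurable borel"
    unfolding c_def by (intro borel_measurable_continuous_onI continuous_intros)
  have [measurable]: "(indicator (ball a (R/4)) :: complex \<Rightarrow> ennreal) \<in> borel_measurable borel"
    by (intro borel_measurable_indicator) auto
  have meas: "(\<lambda>(b, t). indicator (ball a (R/4)) b * (2 * (w (b + c t) * indicator {0..1} t)))
      \<in> borel_measurable (lborel \<Otimes>\<^sub>M lborel)"
    by measurable
  have "ennreal (norm (f a)) * ennreal (pi * (R/4)\<^sup>2) = (\<integral>\<^sup>+b. ennreal (norm (f a)) * indicator (ball a (R/4)) b \<partial>lborel)"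
    using R by (subst nn_integral_cmult_indicator) (auto simp: emeasure_lborel_ball_complex)
  also have "\<dots> \<le> (\<integral>\<^sup>+b. (\<integral>\<^sup>+t. indicator (ball a (R/4)) b * (2 * (w (b + c t) * indicator {0..1} t)) \<partial>lborel) \<partial>lborel)"
  proof (rule nn_integral_mono)
    fix b
    show "ennreal (norm (f a)) * indicator (ball a (R/4)) b \<le> (\<integral>\<^sup>+t. indicator (ball a (R/4)) b * (2 * (w (b + c t) * indicator {0..1} t)) \<partial>lborel)"
    proof (cases "b \<in> ball a (R/4)")
      case True
      have in_ball: "b + c t \<in> ball a R" for t
      proof -
        have "dist b (b + c t) = R / 2" using R by (simp add: c_def dist_norm norm_mult)
        then show ?thesis using True R dist_triangle[of a "b + c t" b] by simp
      qed
      have "ennreal (norm (f a)) \<le> 2 * (\<integral>\<^sup>+t. ennreal (norm (f (circlepath b (R/2) t))) * indicator {0..1} t \<partial>lborel)"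
        using True by (intro norm_le_circle_mean[OF f]) auto
      also have "\<dots> = 2 * (\<integral>\<^sup>+t. w (b + c t) * indicator {0..1} t \<partial>lborel)"
        using in_ball by (simp add: w_def c_def circlepath)
      also have "\<dots> = (\<integral>\<^sup>+t. 2 * (w (b + c t) * indicator {0..1} t) \<partial>lborel)"
        by (subst nn_integral_cmult) auto
      finally show ?thesis using True by simp
    qed auto
  qed
  also have "\<dots> = (\<integral>\<^sup>+t. (\<integral>\<^sup>+b. indicator (ball a (R/4)) b * (2 * (w (b + c t) * indicator {0..1} t)) \<partial>lborel) \<partial>lborel)"
    using meas by (rule lborel_pair.Fubini'[symmetric])
  also have "\<dots> \<le> (\<integral>\<^sup>+t. 2 * J * indicator {0..1::real} t \<partial>lborel)"
  proof (rule nn_integral_mono)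
    fix t :: real
    \<comment> \<open>For fixed \<open>t\<close> the restriction on \<open>b\<close> is dropped and
      the integral over \<open>b\<close> becomes a translate of \<open>J\<close>, so the bound no
      longer involves the position on the circle.\<close>
    have "(\<integral>\<^sup>+b. indicator (ball a (R/4)) b * (2 * (w (b + c t) * indicator {0..1} t)) \<partial>lborel)
        \<le> (\<integral>\<^sup>+b. 2 * indicator {0..1} t * w (c t + 1 *\<^sub>R b) \<partial>lborel)"
      by (intro nn_integral_mono) (auto simp: indicator_def add.commute)
    also have "\<dots> = 2 * indicator {0..1} t * (\<integral>\<^sup>+b. w (c t + 1 *\<^sub>R b) \<partial>lborel)"
      by (intro nn_integral_cmult) measurable
    also have "(\<integral>\<^sup>+b. w (c t + 1 *\<^sub>R b) \<partial>lborel) = J"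
      unfolding J_def by (subst nn_integral_lborel_affine[of w 1 "c t"]) auto
    finally show "(\<integral>\<^sup>+b. indicator (ball a (R/4)) b * (2 * (w (b + c t) * indicator {0..1} t)) \<partial>lborel) \<le> 2 * J * indicator {0..1} t"
      by (simp add: ac_simps)
  qed
  also have "\<dots> = 2 * J" by (simp add: nn_integral_cmult_indicator)
  finally have *: "ennreal (norm (f a)) * ennreal (pi * (R/4)\<^sup>2) \<le> 2 * J" .
  \<comment> \<open>The constant 32 is \<open>2 * 16\<close>: 16 undoes the square of
    \<open>R/4\<close>, and \<open>pi\<close> is estimated below by 1.\<close>
  have "ennreal (norm (f a) * R\<^sup>2) \<le> ennreal (16 * (norm (f a) * (pi * (R/4)\<^sup>2)))"
  proof (rule ennreal_leI)
    have "norm (f a) * R\<^sup>2 * 1 \<le> norm (f a) * R\<^sup>2 * pi"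
      using pi_ge_two by (intro mult_left_mono) auto
    then show "norm (f a) * R\<^sup>2 \<le> 16 * (norm (f a) * (pi * (R/4)\<^sup>2))" by (simp add: field_simps)
  qed
  also have "\<dots> = 16 * (ennreal (norm (f a)) * ennreal (pi * (R/4)\<^sup>2))"
    by (simp add: ennreal_mult)
  also have "\<dots> \<le> 16 * (2 * J)" using * by (intro mult_left_mono) auto
  also have "\<dots> = 32 * J" by (simp add: mult.assoc[symmetric])
  finally show ?thesis by (simp add: J_def w_def)
qed

text \<open>The Hardy--Littlewood argument: at a maximum point \<open>z0\<close> of \<open>M\<close>, \<open>|f|\<close> is comparable to
  \<open>|f z0|\<close> from above on a disc of half the distance \<open>d\<close>, so \<open>|f|\<close> may be replaced by \<open>|f|^p |f z0|^(1-p)\<close>.\<close>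
lemma norm_powr_le_area_integral_le_1:
  assumes p: "0 < p" "p \<le> 1" and f: "f holomorphic_on ball a R" and R: "0 < R"
  shows "ennreal (norm (f a) powr p * R\<^sup>2)
     \<le> ennreal (512 * 4 powr ((1 - p) / p)) * (\<integral>\<^sup>+z. ennreal (norm (f z) powr p) * indicator (ball a R) z \<partial>lborel)"
proof (cases "f a = 0")
  case True
  then show ?thesis by simp
next
  case False
  define r where "r = R / 2"
  \<comment> \<open>The weight vanishes on the boundary of the closed disc, so a maximum point with
    positive value lies in the interior and has room \<open>d > 0\<close> around it.\<close>
  define M where "M z = norm (f z) powr p * (r - dist a z)\<^sup>2" for z
  define J where "J = (\<integral>\<^sup>+z. ennreal (norm (f z) powr p) * indicator (ball a R) z \<partial>lborel)"
  have r: "0 < r" "r < R" using R by (auto simp: r_def)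
  have contf: "continuous_on (cball a r) f"
    using f r by (intro holomorphic_on_imp_continuous_on holomorphic_on_subset[OF f]) auto
  have "continuous_on (cball a r) M"
    unfolding M_def using p by (intro continuous_intros continuous_on_powr' contf) auto
  then obtain z0 where z0: "z0 \<in> cball a r" and max: "\<And>z. z \<in> cball a r \<Longrightarrow> M z \<le> M z0"
    using continuous_attains_sup[of "cball a r" M] r by auto
  define q where "q = norm (f z0)"
  define d where "d = r - dist a z0"
  have "0 < M a" using False r by (simp add: M_def)
  also have "M a \<le> M z0" using r by (intro max) auto
  finally have "0 < M z0" .
  then have q: "0 < q" and d: "0 < d"
    using z0 by (auto simp: M_def q_def d_def zero_less_mult_iff less_le)
  have sub: "ball z0 (d / 2) \<subseteq> cball a r" "ball z0 (d / 2) \<subseteq> ball a R"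
  proof -
    show "ball z0 (d / 2) \<subseteq> cball a r"
    proof
      fix z assume "z \<in> ball z0 (d / 2)"
      then show "z \<in> cball a r" using dist_triangle[of a z z0] d by (auto simp: d_def)
    qed
    then show "ball z0 (d / 2) \<subseteq> ball a R" using r by auto
  qed
  \<comment> \<open>On the half-size disc the weight is at least a quarter of
    \<open>d\<^sup>2\<close>, so maximality gives \<open>|f z|^p \<le> 4 q^p\<close>. Raising this
    to the power \<open>(1 - p) / p \<ge> 0\<close> yields the constant.\<close>
  have le: "norm (f z) \<le> norm (f z) powr p * (4 powr ((1 - p) / p) * q powr (1 - p))" if z: "z \<in> ball z0 (d / 2)" for z
  proof -
    have dz: "d / 2 \<le> r - dist a z" using z dist_triangle[of a z z0] by (auto simp: d_def field_simps)
    have "norm (f z) powr p * (d / 2)\<^sup>2 \<le> M z"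
      unfolding M_def using dz d by (intro mult_left_mono power_mono) auto
    also have "\<dots> \<le> q powr p * d\<^sup>2" using max[of z] sub z by (auto simp: M_def q_def d_def)
    finally have "norm (f z) powr p \<le> 4 * q powr p" using d by (simp add: field_simps)
    then have "(norm (f z) powr p) powr (1 / p) \<le> (4 * q powr p) powr (1 / p)"
      using p by (intro powr_mono2) auto
    then have "norm (f z) \<le> 4 powr (1 / p) * q" using p q by (simp add: powr_powr powr_mult)
    then have "norm (f z) powr (1 - p) \<le> (4 powr (1 / p) * q) powr (1 - p)"
      using p by (intro powr_mono2) auto
    also have "\<dots> = 4 powr ((1 - p) / p) * q powr (1 - p)" using q by (simp add: powr_mult powr_powr)
    finally have "norm (f z) powr p * norm (f z) powr (1 - p) \<le> norm (f z) powr p * (4 powr ((1 - p) / p) * q powr (1 - p))"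
      by (intro mult_left_mono) auto
    then show ?thesis by (simp flip: powr_add)
  qed
  have "ennreal (q * (d / 2)\<^sup>2) \<le> 32 * (\<integral>\<^sup>+z. ennreal (norm (f z)) * indicator (ball z0 (d / 2)) z \<partial>lborel)"
    unfolding q_def using d sub f by (intro norm_le_area_integral) (auto intro: holomorphic_on_subset)
  also have "\<dots> \<le> 32 * (\<integral>\<^sup>+z. ennreal (4 powr ((1 - p) / p) * q powr (1 - p)) * (ennreal (norm (f z) powr p) * indicator (ball a R) z) \<partial>lborel)"
  proof (intro mult_left_mono nn_integral_mono)
    fix z
    show "ennreal (norm (f z)) * indicator (ball z0 (d / 2)) z \<le> ennreal (4 powr ((1 - p) / p) * q powr (1 - p)) * (ennreal (norm (f z) powr p) * indicator (ball a R) z)"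
    proof (cases "z \<in> ball z0 (d / 2)")
      case True
      then have "z \<in> ball a R" using sub by auto
      then show ?thesis using True ennreal_leI[OF le[OF True]] by (simp add: ennreal_mult' ac_simps)
    qed auto
  qed auto
  also have "(\<integral>\<^sup>+z. ennreal (4 powr ((1 - p) / p) * q powr (1 - p)) * (ennreal (norm (f z) powr p) * indicator (ball a R) z) \<partial>lborel)
      = ennreal (4 powr ((1 - p) / p) * q powr (1 - p)) * J"
    unfolding J_def using borel_measurable_powr_indicator[of "ball a R" f p] f
    by (intro nn_integral_cmult) (auto simp: holomorphic_on_imp_continuous_on)
  finally have *: "ennreal (q * (d / 2)\<^sup>2) \<le> 32 * (ennreal (4 powr ((1 - p) / p) * q powr (1 - p)) * J)" .
  \<comment> \<open>512 is \<open>4 * 4 * 32\<close>: one 4 for replacing \<open>R\<close> by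
    \<open>r\<close>, one for replacing \<open>d\<close> by \<open>d / 2\<close>, and 32 from the
    area estimate.\<close>
  have "norm (f a) powr p * R\<^sup>2 = 4 * M a" by (simp add: M_def r_def power2_eq_square)
  also have "\<dots> \<le> 4 * M z0" using \<open>M a \<le> M z0\<close> by simp
  also have "4 * M z0 = 4 * (q powr p * d\<^sup>2)" by (simp add: M_def q_def d_def)
  also have "\<dots> = 16 * q powr (p - 1) * (q * (d / 2)\<^sup>2)"
    using q by (simp add: powr_diff power2_eq_square)
  finally have "ennreal (norm (f a) powr p * R\<^sup>2) \<le> ennreal (16 * q powr (p - 1) * (q * (d / 2)\<^sup>2))"
    by (rule ennreal_leI)
  also have "\<dots> = ennreal (16 * q powr (p - 1)) * ennreal (q * (d / 2)\<^sup>2)"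
    using q by (intro ennreal_mult) auto
  also have "\<dots> \<le> ennreal (16 * q powr (p - 1)) * (32 * (ennreal (4 powr ((1 - p) / p) * q powr (1 - p)) * J))"
    using * by (intro mult_left_mono) auto
  also have "\<dots> = ennreal (16 * q powr (p - 1) * 32 * (4 powr ((1 - p) / p) * q powr (1 - p))) * J"
    by (subst (1 2) ennreal_mult) (auto simp: ac_simps)
  also have "16 * q powr (p - 1) * 32 * (4 powr ((1 - p) / p) * q powr (1 - p)) = 512 * 4 powr ((1 - p) / p)"
    using q by (simp add: powr_diff)
  finally show ?thesis unfolding J_def .
qed

text \<open>Large exponents reduce to \<open>q = p / m \<le> 1\<close> by passing to the holomorphic
  function \<open>f^m\<close>, because \<open>|f^m|^q = |f|^p\<close>.\<close>

lemma norm_powr_le_area_integral: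
  assumes p: "0 < p"
  shows "\<exists>K>0. \<forall>f a R. 0 < R \<longrightarrow> f holomorphic_on ball a R \<longrightarrow>
     ennreal (norm (f a) powr p * R\<^sup>2) \<le> ennreal K * (\<integral>\<^sup>+z. ennreal (norm (f z) powr p) * indicator (ball a R) z \<partial>lborel)"
proof -
  define m where "m = nat \<lceil>p\<rceil>"
  have m: "1 \<le> m" "p \<le> m" unfolding m_def using p by linarith+
  define q where "q = p / m"
  have q: "0 < q" "q \<le> 1" using p m by (auto simp: q_def)
  have pw: "norm (x ^ m) powr q = norm x powr p" for x :: complex
  proof (cases "x = 0")
    case False
    then have "norm (x ^ m) powr q = (norm x powr m) powr q" by (simp add: norm_power powr_realpow)
    also have "\<dots> = norm x powr p" using m by (simp add: powr_powr q_def)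
    finally show ?thesis .
  qed (use m in auto)
  have "ennreal (norm (f a) powr p * R\<^sup>2) \<le> ennreal (512 * 4 powr ((1 - q) / q)) * (\<integral>\<^sup>+z. ennreal (norm (f z) powr p) * indicator (ball a R) z \<partial>lborel)"
    if "0 < R" "f holomorphic_on ball a R" for f a R
    using norm_powr_le_area_integral_le_1[of q "\<lambda>z. f z ^ m" a R] q that
    by (simp add: pw holomorphic_intros)
  then show ?thesis by (intro exI[of _ "512 * 4 powr ((1 - q) / q)"]) auto
qed

text \<open>Cauchy's estimate on the circle of radius \<open>R/2\<close> bounds the derivative by
  the value of \<open>|f|\<close> at a maximum point \<open>x\<close> of that circle. The sub-mean
  value estimate is then applied on \<open>ball x (R/2)\<close>, which still lies in
  \<open>ball a R\<close>.\<close>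

lemma higher_deriv_powr_le_area_integral:
  assumes p: "0 < p"
  shows "\<exists>K>0. \<forall>f a R. 0 < R \<longrightarrow> f holomorphic_on ball a R \<longrightarrow>
     ennreal ((norm ((deriv ^^ n) f a) * R ^ n) powr p * R\<^sup>2)
       \<le> ennreal K * (\<integral>\<^sup>+z. ennreal (norm (f z) powr p) * indicator (ball a R) z \<partial>lborel)"
proof -
  obtain K where K: "0 < K" "\<And>f a R. 0 < R \<Longrightarrow> f holomorphic_on ball a R \<Longrightarrow>
     ennreal (norm (f a) powr p * R\<^sup>2) \<le> ennreal K * (\<integral>\<^sup>+z. ennreal (norm (f z) powr p) * indicator (ball a R) z \<partial>lborel)"
    using norm_powr_le_area_integral[OF p] by blast
  \<comment> \<open>\<open>fact n * 2 ^ n\<close> is the Cauchy constant for radius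
    \<open>R/2\<close>, and 4 compensates the passage from \<open>R\<close> to \<open>R/2\<close> in
    the area factor.\<close>
  define c where "c = 4 * (fact n * 2 ^ n :: real) powr p"
  have c: "0 < c" by (simp add: c_def)
  have "ennreal ((norm ((deriv ^^ n) f a) * R ^ n) powr p * R\<^sup>2)
       \<le> ennreal (c * K) * (\<integral>\<^sup>+z. ennreal (norm (f z) powr p) * indicator (ball a R) z \<partial>lborel)"
    if R: "0 < R" and f: "f holomorphic_on ball a R" for f a R
  proof -
    have cont: "continuous_on (cball a (R/2)) f"
      using R by (intro holomorphic_on_imp_continuous_on holomorphic_on_subset[OF f]) auto
    have "sphere a (R/2) \<noteq> {}" using R by simp
    moreover have "continuous_on (sphere a (R/2)) (\<lambda>z. norm (f z))"
      using cont by (intro continuous_intros) (auto intro: continuous_on_subset)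
    ultimately obtain x where x: "x \<in> sphere a (R/2)" "\<And>z. z \<in> sphere a (R/2) \<Longrightarrow> norm (f z) \<le> norm (f x)"
      using continuous_attains_sup[of "sphere a (R/2)" "\<lambda>z. norm (f z)"] by auto
    have "f holomorphic_on ball a (R/2)"
      using R by (intro holomorphic_on_subset[OF f]) auto
    then have "norm ((deriv ^^ n) f a) \<le> fact n * norm (f x) / (R/2) ^ n"
      using R x(2) cont by (intro Cauchy_inequality) (auto simp: dist_norm)
    then have "norm ((deriv ^^ n) f a) * R ^ n \<le> (fact n * 2 ^ n) * norm (f x)"
      using R by (simp add: field_simps)
    then have "(norm ((deriv ^^ n) f a) * R ^ n) powr p \<le> ((fact n * 2 ^ n) * norm (f x)) powr p"
      using p R by (intro powr_mono2) auto
    also have "\<dots> = (fact n * 2 ^ n) powr p * norm (f x) powr p" by (simp add: powr_mult)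
    finally have "(norm ((deriv ^^ n) f a) * R ^ n) powr p * R\<^sup>2 \<le> (fact n * 2 ^ n) powr p * norm (f x) powr p * R\<^sup>2"
      by (intro mult_right_mono) auto
    also have "\<dots> = c * (norm (f x) powr p * (R/2)\<^sup>2)" by (simp add: c_def power2_eq_square)
    finally have "ennreal ((norm ((deriv ^^ n) f a) * R ^ n) powr p * R\<^sup>2) \<le> ennreal (c * (norm (f x) powr p * (R/2)\<^sup>2))"
      by (rule ennreal_leI)
    also have "\<dots> = ennreal c * ennreal (norm (f x) powr p * (R/2)\<^sup>2)" using c by (intro ennreal_mult) auto
    also have "\<dots> \<le> ennreal c * (ennreal K * (\<integral>\<^sup>+z. ennreal (norm (f z) powr p) * indicator (ball a R) z \<partial>lborel))"
    proof (intro mult_left_mono)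
      have sub: "ball x (R/2) \<subseteq> ball a R"
      proof
        fix z assume "z \<in> ball x (R/2)"
        then show "z \<in> ball a R" using x(1) dist_triangle[of a z x] by auto
      qed
      have "ennreal (norm (f x) powr p * (R/2)\<^sup>2) \<le> ennreal K * (\<integral>\<^sup>+z. ennreal (norm (f z) powr p) * indicator (ball x (R/2)) z \<partial>lborel)"
        using R sub by (intro K(2)) (auto intro: holomorphic_on_subset[OF f])
      also have "\<dots> \<le> ennreal K * (\<integral>\<^sup>+z. ennreal (norm (f z) powr p) * indicator (ball a R) z \<partial>lborel)"
        using sub by (intro mult_left_mono nn_integral_mono) (auto simp: indicator_def)
      finally show "ennreal (norm (f x) powr p * (R/2)\<^sup>2) \<le> \<dots>" .
    qed auto
    also have "\<dots> = ennreal (c * K) * (\<integral>\<^sup>+z. ennreal (norm (f z) powr p) * indicator (ball a R) z \<partial>lborel)"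
      using c K(1) by (simp add: ennreal_mult mult.assoc)
    finally show ?thesis .
  qed
  then show ?thesis using c K(1) by (intro exI[of _ "c * K"]) auto
qed

section \<open>Integration over Carleson boxes\<close>

lemma emeasure_lborel_cball_complex:
  fixes c :: complex
  assumes "0 \<le> r"
  shows "emeasure lborel (cball c r) = ennreal (pi * r\<^sup>2)"
  using emeasure_cball[of r c] assms by (simp add: unit_ball_vol_2)

text \<open>The primitive \<open>- 2 * sqrt (m - s)\<close> is continuous on the closed interval but
  not differentiable at \<open>m\<close>, so the fundamental theorem is used in the form that asks
  for derivatives in the interior only.\<close>

lemma nn_integral_inverse_sqrt:
  assumes "0 \<le> m"
  shows "(\<integral>\<^sup>+s. ennreal ((m - s) powr (-1/2) * indicator {0..m} s) \<partial>lborel) = ennreal (2 * sqrt m)"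
proof (rule nn_integral_has_integral_lborel)
  show "(\<lambda>s. (m - s) powr (-1/2) * indicator {0..m} s) \<in> borel_measurable borel" by measurable
  have "((\<lambda>s. (m - s) powr (-1/2)) has_integral (- 2 * sqrt (m - m) - (- 2 * sqrt (m - 0)))) {0..m}"
  proof (rule fundamental_theorem_of_calculus_interior)
    show "continuous_on {0..m} (\<lambda>s. - 2 * sqrt (m - s))" by (intro continuous_intros)
    show "((\<lambda>s. - 2 * sqrt (m - s)) has_vector_derivative (m - s) powr (-1/2)) (at s)"
      if "s \<in> {0<..<m}" for s
      unfolding has_real_derivative_iff_has_vector_derivative[symmetric]
      using that by (auto intro!: derivative_eq_intros simp: powr_minus powr_half_sqrt field_simps)
  qed (use assms in auto)
  then have "((\<lambda>s. (m - s) powr (-1/2)) has_integral 2 * sqrt m) {0..m}" by simp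
  then have "((\<lambda>s. if s \<in> {0..m} then (m - s) powr (-1/2) else 0) has_integral 2 * sqrt m) UNIV"
    by (simp only: has_integral_restrict_UNIV)
  then show "((\<lambda>s. (m - s) powr (-1/2) * indicator {0..m} s) has_integral 2 * sqrt m) UNIV"
    by (rule has_integral_eq[rotated]) (auto simp: indicator_def)
qed auto

text \<open>The dilations by \<open>1 - s\<close> with \<open>0 \<le> s \<le> d/2\<close> distort the integral by a bounded factor;
  averaging over \<open>s\<close> turns the singularity into a one-dimensional one.\<close>
lemma nn_integral_carleson_box:
  fixes \<zeta> :: complex
  assumes "norm \<zeta> < 1"
  defines "d \<equiv> 1 - norm \<zeta>"
  shows "(\<integral>\<^sup>+z. ennreal ((1 - norm z) powr (-1/2)) * indicator (ball 0 1 \<inter> cball \<zeta> (3 * d)) z \<partial>lborel)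
           \<le> ennreal (640 * pi * d powr (3/2))"
proof -
  define u where "u z = ennreal ((1 - norm z) powr (-1/2)) * indicator (ball 0 1 \<inter> cball \<zeta> (3 * d)) z" for z :: complex
  define h where "h m s = ennreal ((m - s) powr (-1/2) * indicator {0..m} s)" for m s :: real
  have d: "0 < d" "d \<le> 1" using assms by (auto simp: d_def)
  have u[measurable]: "u \<in> borel_measurable borel" unfolding u_def
    by (intro borel_measurable_times_ennreal borel_measurable_indicator measurable_compose[OF _ measurable_ennreal]) auto
  \<comment> \<open>Substitute \<open>z = c w\<close> with \<open>c = 1 / (1 - s)\<close> in
    \<open>[1, 2]\<close>. The Jacobian is \<open>c\<^sup>2 \<le> 4\<close>, the identity
    \<open>1 - c|w| = c (1 - s - |w|)\<close> controls the weight, and points move by at most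
    \<open>d/2\<close>, which enlarges the disc from \<open>3 * d\<close> to
    \<open>4 * d\<close>.\<close>
  have scaled: "(\<integral>\<^sup>+z. u z \<partial>lborel) \<le> 4 * (\<integral>\<^sup>+w. indicator (cball \<zeta> (4 * d)) w * h (1 - norm w) s \<partial>lborel)"
    if s: "s \<in> {0..d/2}" for s
  proof -
    define c where "c = 1 / (1 - s)"
    have s': "0 \<le> s" "s \<le> 1/2" "s \<le> d/2" using s d by auto
    have c: "1 \<le> c" "c \<le> 2" "c * (1 - s) = 1" using s' by (auto simp: c_def divide_simps)
    have c2: "c\<^sup>2 \<le> 4" using power_mono[of c 2 2] c by simp
    have "(\<integral>\<^sup>+z. u z \<partial>lborel) = ennreal (c\<^sup>2) * (\<integral>\<^sup>+w. u (0 + c *\<^sub>R w) \<partial>lborel)"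
      using c by (subst nn_integral_lborel_affine[of u c 0]) auto
    also have "\<dots> \<le> 4 * (\<integral>\<^sup>+w. indicator (cball \<zeta> (4 * d)) w * h (1 - norm w) s \<partial>lborel)"
    proof (intro mult_mono nn_integral_mono)
      show "ennreal (c\<^sup>2) \<le> 4" using c2 by (metis ennreal_leI ennreal_numeral zero_le_numeral)
      fix w :: complex
      show "u (0 + c *\<^sub>R w) \<le> indicator (cball \<zeta> (4 * d)) w * h (1 - norm w) s"
      proof (cases "0 + c *\<^sub>R w \<in> ball 0 1 \<inter> cball \<zeta> (3 * d)")
        case True
        have cw: "c * norm w < 1" and cz: "dist \<zeta> (c *\<^sub>R w) \<le> 3 * d" using True c by auto
        have ws: "norm w < 1 - s"
        proof -
          have "c * norm w * (1 - s) < 1 * (1 - s)" using cw s' by (intro mult_strict_right_mono) auto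
          also have "c * norm w * (1 - s) = norm w * (c * (1 - s))" by (simp only: ac_simps)
          finally show ?thesis using c(3) by simp
        qed
        have "1 - c * norm w = c * (1 - s - norm w)" using c(3) by (simp add: algebra_simps)
        also have "\<dots> \<ge> 1 * (1 - s - norm w)" using ws c by (intro mult_right_mono) auto
        finally have "1 - s - norm w \<le> 1 - c * norm w" by simp
        then have le: "(1 - c * norm w) powr (-1/2) \<le> (1 - norm w - s) powr (-1/2)"
          using ws by (intro powr_mono2') auto
        have "dist (c *\<^sub>R w) w = s * (c * norm w)"
        proof -
          have "c - 1 = c * s" using c(3) by (simp add: algebra_simps)
          moreover have "c *\<^sub>R w - w = (c - 1) *\<^sub>R w" by (simp add: algebra_simps)
          ultimately show ?thesis using c s' by (simp add: dist_norm)
        qed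
        also have "\<dots> \<le> (d/2) * 1" using cw s' c d by (intro mult_mono) auto
        finally have "dist \<zeta> w \<le> 4 * d" using cz d dist_triangle[of \<zeta> w "c *\<^sub>R w"] by simp
        then show ?thesis using True le ws s' c by (auto simp: u_def h_def indicator_def intro!: ennreal_leI)
      qed (auto simp: u_def)
    qed auto
    finally show ?thesis .
  qed
  have h_meas[measurable]: "(\<lambda>(w, s). indicator (cball \<zeta> (4 * d)) w * h (1 - norm w) s) \<in> borel_measurable (borel \<Otimes>\<^sub>M borel)"
  proof -
    have [measurable]: "(indicator (cball \<zeta> (4 * d)) :: complex \<Rightarrow> ennreal) \<in> borel_measurable borel"
      by (intro borel_measurable_indicator) auto
    show ?thesis unfolding h_def indicator_def[of "{0.._}"] atLeastAtMost_iff by measurable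
  qed
  \<comment> \<open>The integral of \<open>u\<close> is constant in \<open>s\<close>, so integrating
    the estimate over \<open>{0..d/2}\<close> multiplies it by \<open>d / 2\<close>.\<close>
  have "ennreal (d / 2) * (\<integral>\<^sup>+z. u z \<partial>lborel) = (\<integral>\<^sup>+s. (\<integral>\<^sup>+z. u z \<partial>lborel) * indicator {0..d/2} s \<partial>lborel)"
    using d by (simp add: nn_integral_cmult_indicator mult.commute)
  also have "\<dots> \<le> (\<integral>\<^sup>+s. 4 * (\<integral>\<^sup>+w. indicator (cball \<zeta> (4 * d)) w * h (1 - norm w) s \<partial>lborel) \<partial>lborel)"
    using scaled by (intro nn_integral_mono) (auto simp: indicator_def)
  also have "\<dots> = 4 * (\<integral>\<^sup>+s. \<integral>\<^sup>+w. indicator (cball \<zeta> (4 * d)) w * h (1 - norm w) s \<partial>lborel \<partial>lborel)"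
    using h_meas by (intro nn_integral_cmult) measurable
  finally have 1: "ennreal (d / 2) * (\<integral>\<^sup>+z. u z \<partial>lborel)
      \<le> 4 * (\<integral>\<^sup>+s. \<integral>\<^sup>+w. indicator (cball \<zeta> (4 * d)) w * h (1 - norm w) s \<partial>lborel \<partial>lborel)" .
  have "(\<integral>\<^sup>+s. \<integral>\<^sup>+w. indicator (cball \<zeta> (4 * d)) w * h (1 - norm w) s \<partial>lborel \<partial>lborel)
     = (\<integral>\<^sup>+w. \<integral>\<^sup>+s. indicator (cball \<zeta> (4 * d)) w * h (1 - norm w) s \<partial>lborel \<partial>lborel)"
    using h_meas by (intro lborel_pair.Fubini') auto
  also have "\<dots> \<le> (\<integral>\<^sup>+w. ennreal (5 * sqrt d) * indicator (cball \<zeta> (4 * d)) w \<partial>lborel)"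
  proof (rule nn_integral_mono)
    fix w :: complex
    show "(\<integral>\<^sup>+s. indicator (cball \<zeta> (4 * d)) w * h (1 - norm w) s \<partial>lborel) \<le> ennreal (5 * sqrt d) * indicator (cball \<zeta> (4 * d)) w"
    proof (cases "w \<in> cball \<zeta> (4 * d) \<and> 0 \<le> 1 - norm w")
      case True
      \<comment> \<open>The singular integral in \<open>s\<close> is thus at most
        \<open>2 * sqrt (5 * d)\<close>, and \<open>sqrt 5 \<le> 5/2\<close>.\<close>
      have "1 - norm w \<le> 5 * d" using True norm_triangle_ineq2[of \<zeta> w] by (simp add: d_def dist_norm)
      then have "2 * sqrt (1 - norm w) \<le> 2 * sqrt (5 * d)" by simp
      also have "\<dots> = 2 * sqrt 5 * sqrt d" by (simp add: real_sqrt_mult)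
      also have "\<dots> \<le> 2 * (5/2) * sqrt d"
        using d by (intro mult_right_mono mult_left_mono real_le_lsqrt) (auto simp: power2_eq_square)
      finally have "2 * sqrt (1 - norm w) \<le> 5 * sqrt d" by simp
      then show ?thesis using True nn_integral_inverse_sqrt[of "1 - norm w"]
        by (auto simp: h_def intro!: ennreal_leI)
    qed (auto simp: h_def)
  qed
  also have "\<dots> = ennreal (5 * sqrt d * (pi * (4 * d)\<^sup>2))"
    using d by (simp add: nn_integral_cmult_indicator emeasure_lborel_cball_complex flip: ennreal_mult)
  finally have "ennreal (d / 2) * (\<integral>\<^sup>+z. u z \<partial>lborel) \<le> 4 * ennreal (5 * sqrt d * (pi * (4 * d)\<^sup>2))"
    using 1 by (meson mult_left_mono order_trans zero_le)
  also have "\<dots> = ennreal (4 * (5 * sqrt d * (pi * (4 * d)\<^sup>2)))"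
    using d by (subst ennreal_mult) auto
  also have "4 * (5 * sqrt d * (pi * (4 * d)\<^sup>2)) = 320 * pi * sqrt d * d\<^sup>2"
    by (simp add: power2_eq_square)
  \<comment> \<open>Multiplying by \<open>2 / d\<close> cancels the averaging factor and turns
    \<open>sqrt d * d\<^sup>2\<close> into \<open>2 * d powr (3/2)\<close>, whence
    \<open>640 = 2 * 320\<close>.\<close>
  finally have "ennreal (2 / d) * (ennreal (d / 2) * (\<integral>\<^sup>+z. u z \<partial>lborel)) \<le> ennreal (2 / d) * ennreal (320 * pi * sqrt d * d\<^sup>2)"
    by (intro mult_left_mono) auto
  also have "ennreal (2 / d) * ennreal (320 * pi * sqrt d * d\<^sup>2) = ennreal (640 * pi * d powr (3/2))"
  proof -
    have "d powr (3/2) = d powr (1 + 1/2)" by simp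
    also have "\<dots> = d * sqrt d" using d by (subst powr_add) (simp add: powr_half_sqrt)
    finally show ?thesis using d by (simp flip: ennreal_mult add: power2_eq_square)
  qed
  also have "ennreal (2 / d) * (ennreal (d / 2) * (\<integral>\<^sup>+z. u z \<partial>lborel)) = (\<integral>\<^sup>+z. u z \<partial>lborel)"
    using d by (simp add: mult.assoc[symmetric] ennreal_mult[symmetric])
  finally show ?thesis by (simp add: u_def)
qed

section \<open>Solutions in the Bergman space\<close>

lemma has_field_derivative_intop:
  assumes f: "f holomorphic_on unit_disc" and z: "z \<in> unit_disc"
  shows "(intop f has_field_derivative f z) (at z)"
  unfolding intop_def
\<comment> \<open>The disc is starlike about 0, and integrals over triangles with vertex 0 vanish by
  Cauchy's theorem, so radial integration gives a primitive.\<close>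
proof (rule triangle_contour_integrals_starlike_primitive[of unit_disc])
  show "continuous_on unit_disc f" using f by (rule holomorphic_on_imp_continuous_on)
  show seg: "closed_segment 0 y \<subseteq> unit_disc" if "y \<in> unit_disc" for y :: complex
    using that by (intro closed_segment_subset) auto
  show "contour_integral (linepath 0 b) f + contour_integral (linepath b c) f + contour_integral (linepath c 0) f = 0"
    if "closed_segment b c \<subseteq> unit_disc" for b c
  proof (rule has_chain_integral_chain_integral3)
    have "convex hull {0, b, c} \<subseteq> unit_disc"
      using that by (intro hull_minimal) auto
    then show "(f has_contour_integral 0) (linepath 0 b +++ linepath b c +++ linepath c 0)"
      by (intro Cauchy_theorem_triangle holomorphic_on_subset[OF f])
  qed
qed (use z in auto)

lemma holomorphic_on_funpow_intop:
  assumes "f holomorphic_on unit_disc"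
  shows "(intop ^^ n) f holomorphic_on unit_disc"
proof (induction n)
  case (Suc n)
  have "\<exists>f'. (intop ((intop ^^ n) f) has_field_derivative f') (at z)" if "z \<in> unit_disc" for z
    using has_field_derivative_intop[OF Suc that] by blast
  then show ?case by (simp add: holomorphic_on_open)
qed (use assms in simp)

lemma higher_deriv_funpow_intop:
  assumes f: "f holomorphic_on unit_disc" and z: "z \<in> unit_disc"
  shows "(deriv ^^ n) ((intop ^^ n) f) z = f z"
proof (induction n)
  case (Suc n)
  let ?g = "(intop ^^ n) f"
  have "(deriv ^^ Suc n) ((intop ^^ Suc n) f) z = (deriv ^^ n) (deriv (intop ?g)) z"
    by (simp add: funpow_swap1)
  also have "\<dots> = (deriv ^^ n) ?g z"
  proof (rule higher_deriv_cong_ev)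
    \<comment> \<open>\<open>deriv (intop ?g)\<close> is known to agree with \<open>?g\<close> only
      on the disc. Agreement near \<open>z\<close> suffices for all higher derivatives at
      \<open>z\<close>.\<close>
    have "\<forall>\<^sub>F x in nhds z. x \<in> unit_disc" using z by (intro eventually_nhds_in_open) auto
    then show "\<forall>\<^sub>F x in nhds z. deriv (intop ?g) x = ?g x"
      by eventually_elim (intro DERIV_imp_deriv has_field_derivative_intop holomorphic_on_funpow_intop f)
  qed simp
  finally show ?case using Suc by simp
qed simp

section \<open>Pointwise growth of solutions\<close>

lemma continuous_on_higher_deriv:
  assumes "f holomorphic_on unit_disc" "\<rho> < 1"
  shows "continuous_on (cball 0 \<rho>) ((deriv ^^ k) f)"
  using assms
  by (intro holomorphic_on_imp_continuous_on holomorphic_on_subset[OF holomorphic_higher_deriv[of f unit_disc]]) auto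

text \<open>The radial bound is applied on every ray from radius \<open>\<rho>\<close> outwards. By
  compactness the derivatives of \<open>f\<close> are bounded on \<open>cball 0 \<rho>\<close> by
  one \<open>Y\<close> for all directions, so \<open>C\<close> depends on neither \<open>z\<close>
  nor \<open>\<Lambda>\<close>.\<close>

lemma solution_pointwise_bound:
  assumes b: "0 < b" and n: "n \<ge> 1" and \<rho>: "0 \<le> \<rho>" "\<rho> < 1"
    and g: "\<And>k z. k < n \<Longrightarrow> \<rho> \<le> norm z \<Longrightarrow> norm z < 1 \<Longrightarrow>
               norm (g k z) \<le> b / 2 * (1 - norm z) powr (- real (n - k))"
    and sol: "is_solution n g F f"
  shows "\<exists>C>0. \<forall>z \<Lambda>. norm z < 1 \<longrightarrow> 0 \<le> \<Lambda> \<longrightarrow>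
      (\<forall>s\<in>{0..1}. norm (F (of_real s * z)) \<le> \<Lambda> * (1 - s * norm z) powr (-(b + n))) \<longrightarrow>
      norm (f z) \<le> C * (1 + \<Lambda>) * (1 - norm z) powr (-b)"
proof -
  have f: "f holomorphic_on unit_disc"
    and eq: "\<And>z. norm z < 1 \<Longrightarrow> (deriv ^^ n) f z + (\<Sum>k<n. g k z * (deriv ^^ k) f z) = F z"
    using sol by (auto simp: is_solution_def)
  have "\<exists>M>0. \<forall>z\<in>cball 0 \<rho>. norm ((deriv ^^ k) f z) \<le> M" for k
  proof -
    have "bounded ((deriv ^^ k) f ` cball 0 \<rho>)"
      using f \<rho> by (intro compact_imp_bounded compact_continuous_image continuous_on_higher_deriv) auto
    then show ?thesis by (auto simp: bounded_pos)
  qed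
  then obtain M where M: "\<And>k. 0 < M k" "\<And>k z. norm z \<le> \<rho> \<Longrightarrow> norm ((deriv ^^ k) f z) \<le> M k"
    by (metis mem_cball_0)
  define Y where "Y = (\<Sum>k<n. M k)"
  have Y: "norm ((deriv ^^ k) f z) \<le> Y" if "k < n" "norm z \<le> \<rho>" for k z
  proof -
    have "M k \<le> Y" unfolding Y_def using that M(1) by (intro member_le_sum) (auto intro: less_imp_le)
    then show ?thesis using M(2)[OF that(2), of k] by simp
  qed
  have Y0: "0 < Y" unfolding Y_def using n M(1) by (intro sum_pos) (auto simp: lessThan_empty_iff)
  define S where "S = 1 / pochhammer b n + (\<Sum>k<n. Y / pochhammer b k)"
  have P: "0 < pochhammer b k" for k using b by (rule pochhammer_pos)
  have S: "0 \<le> (\<Sum>k<n. Y / pochhammer b k)"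
    using Y0 P by (intro sum_nonneg divide_nonneg_nonneg) (auto intro: less_imp_le)
  have S0: "0 < S" unfolding S_def using S P[of n] by (simp add: add_pos_nonneg)
  \<comment> \<open>The summand \<open>Y\<close> settles the case
    \<open>norm z \<le> \<rho>\<close>; \<open>2 * S\<close> is the constant of the radial bound
    with \<open>\<Lambda>\<close> replaced by 1.\<close>
  have "norm (f z) \<le> (Y + 2 * S) * (1 + \<Lambda>) * (1 - norm z) powr (-b)"
    if z: "norm z < 1" and \<Lambda>: "0 \<le> \<Lambda>"
      and F: "\<forall>s\<in>{0..1}. norm (F (of_real s * z)) \<le> \<Lambda> * (1 - s * norm z) powr (-(b + n))" for z \<Lambda>
  proof (cases "norm z \<le> \<rho>")
    case True
    have "norm (f z) \<le> Y" using Y[of 0 z] n True by simp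
    also have "Y = Y * 1 * 1" by simp
    also have "\<dots> \<le> (Y + 2 * S) * (1 + \<Lambda>) * (1 - norm z) powr (-b)"
      using Y0 S0 \<Lambda> z b by (intro mult_mono one_le_powr_minus) auto
    finally show ?thesis .
  next
    case False
    define e where "e = sgn z"
    have z0: "z \<noteq> 0" using False \<rho> by auto
    have e: "norm e = 1" "of_real (norm z) * e = z"
      using z0 by (simp add: e_def norm_sgn, simp add: e_def sgn_eq)
    have nx: "norm (of_real x * e) = x" if "0 \<le> x" for x
      using that e by (simp add: norm_mult)
    have "norm ((deriv ^^ 0) f (of_real (norm z) * e))
        \<le> 2 * (\<Lambda> / pochhammer b n + (\<Sum>k<n. Y / pochhammer b k)) * (1 - norm z) powr (-b)"
    proof (rule radial_growth_bound[where \<phi> = "\<lambda>k x. (deriv ^^ k) f (of_real x * e)" and r = \<rho> and e = e])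
      show "((\<lambda>x. (deriv ^^ k) f (of_real x * e)) has_vector_derivative e * (deriv ^^ Suc k) f (of_real x * e)) (at x)"
        if "\<rho> \<le> x" "x \<le> norm z" for k x
      proof -
        have "of_real x * e \<in> unit_disc" using that nx[of x] \<rho> z by simp
        then have "((deriv ^^ k) f has_field_derivative (deriv ^^ Suc k) f (of_real x * e)) (at (of_real x * e))"
          using holomorphic_derivI[OF holomorphic_higher_deriv[OF f] open_ball] by auto
        moreover have "((\<lambda>x. of_real x * e) has_vector_derivative e) (at x)"
          by (auto intro!: derivative_eq_intros)
        ultimately show ?thesis
          using field_vector_diff_chain_at[of "\<lambda>x. of_real x * e" e x "(deriv ^^ k) f"] by (simp add: o_def)
      qed
      show "norm ((deriv ^^ k) f (of_real \<rho> * e)) \<le> Y" if "k < n" for k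
        using Y[OF that, of "of_real \<rho> * e"] nx[of \<rho>] \<rho> by simp
      fix x assume x: "\<rho> \<le> x" "x \<le> norm z"
      let ?w = "of_real x * e"
      have w: "norm ?w = x" "norm ?w < 1" using nx[of x] x \<rho> z by auto
      \<comment> \<open>The point at radius \<open>x\<close> on the ray is \<open>s z\<close> with
        \<open>s = x / norm z\<close>, which is where the hypothesis on \<open>F\<close> is
        used.\<close>
      have "?w = of_real (x / norm z) * z" using e(2) z0 by (simp add: e_def sgn_eq)
      moreover have "x / norm z \<in> {0..1}" using x \<rho> z0 by (simp add: field_simps)
      ultimately have Fw: "norm (F ?w) \<le> \<Lambda> * (1 - x) powr (-(b + n))"
        using F[rule_format, of "x / norm z"] z0 by simp
      have "(deriv ^^ n) f ?w = F ?w - (\<Sum>k<n. g k ?w * (deriv ^^ k) f ?w)"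
        using eq[OF w(2)] by (simp add: algebra_simps)
      then have "norm ((deriv ^^ n) f ?w) \<le> norm (F ?w) + norm (\<Sum>k<n. g k ?w * (deriv ^^ k) f ?w)"
        by (metis norm_triangle_ineq4)
      also have "norm (\<Sum>k<n. g k ?w * (deriv ^^ k) f ?w)
          \<le> (\<Sum>k<n. b / 2 * (1 - x) powr (- real (n - k)) * norm ((deriv ^^ k) f ?w))"
      proof (rule sum_norm_le)
        fix k assume "k \<in> {..<n}"
        then show "norm (g k ?w * (deriv ^^ k) f ?w) \<le> b / 2 * (1 - x) powr (- real (n - k)) * norm ((deriv ^^ k) f ?w)"
          using g[of k ?w] w x unfolding norm_mult[of "g k ?w"] by (intro mult_right_mono) auto
      qed
      finally show "norm ((deriv ^^ n) f ?w) \<le> \<Lambda> * (1 - x) powr (-(b + n))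
          + (\<Sum>k<n. b / 2 * (1 - x) powr (- real (n - k)) * norm ((deriv ^^ k) f ?w))"
        using Fw by simp
    qed (use b n \<rho> False z e Y0 \<Lambda> in auto)
    then have "norm (f z) \<le> 2 * (\<Lambda> / pochhammer b n + (\<Sum>k<n. Y / pochhammer b k)) * (1 - norm z) powr (-b)"
      using e by simp
    also have "\<dots> \<le> (Y + 2 * S) * (1 + \<Lambda>) * (1 - norm z) powr (-b)"
    proof (intro mult_right_mono)
      have "2 * (\<Lambda> * x + T) \<le> (Y + 2 * (x + T)) * (1 + \<Lambda>)" if "0 \<le> x" "0 \<le> T" for x T
      proof -
        have "0 \<le> \<Lambda> * T" "0 \<le> Y * (1 + \<Lambda>)" using that \<Lambda> Y0 by auto
        then show ?thesis using that by (simp add: algebra_simps)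
      qed
      from this[of "1 / pochhammer b n" "\<Sum>k<n. Y / pochhammer b k"]
      show "2 * (\<Lambda> / pochhammer b n + (\<Sum>k<n. Y / pochhammer b k)) \<le> (Y + 2 * S) * (1 + \<Lambda>)"
        unfolding S_def using S P[of n] by simp
    qed auto
    finally show ?thesis .
  qed
  then show ?thesis using Y0 S0 by (intro exI[of _ "Y + 2 * S"]) auto
qed

section \<open>The Carleson average and its weighted integral\<close>

text \<open>For fixed \<open>\<zeta>\<close> the admissible \<open>z\<close> in the disc form a
  Carleson box of size \<open>1 - norm \<zeta>\<close>, and the exponent \<open>-3/2\<close> is
  chosen to cancel the integral over that box. Values in \<open>ennreal\<close> allow the average to
  be infinite at some \<open>z\<close>.\<close>

definition carleson_average :: "real \<Rightarrow> (complex \<Rightarrow> complex) \<Rightarrow> complex \<Rightarrow> ennreal" where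
  "carleson_average p G z = (\<integral>\<^sup>+\<zeta>. ennreal (norm (G \<zeta>) powr p) * indicator unit_disc \<zeta>
     * (ennreal ((1 - norm \<zeta>) powr (-3/2)) * indicator {\<zeta>. dist \<zeta> z \<le> 3 * (1 - norm \<zeta>)} \<zeta>) \<partial>lborel)"

lemma borel_measurable_carleson_average:
  assumes G: "G holomorphic_on unit_disc"
  shows "carleson_average p G \<in> borel_measurable borel"
proof -
  have [measurable]: "(\<lambda>\<zeta>. ennreal (norm (G \<zeta>) powr p) * indicator unit_disc \<zeta>) \<in> borel_measurable borel"
    using G by (intro borel_measurable_powr_indicator holomorphic_on_imp_continuous_on) auto
  \<comment> \<open>The condition depends on \<open>z\<close> and \<open>\<zeta>\<close> together;
    written as a conditional instead of an indicator, it is visibly jointly measurable.\<close>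
  have "(\<lambda>z. \<integral>\<^sup>+\<zeta>. ennreal (norm (G \<zeta>) powr p) * indicator unit_disc \<zeta>
     * (ennreal ((1 - norm \<zeta>) powr (-3/2)) * (if dist \<zeta> z \<le> 3 * (1 - norm \<zeta>) then 1 else 0)) \<partial>lborel)
     \<in> borel_measurable borel"
    by measurable
  then show ?thesis by (simp add: carleson_average_def[abs_def] indicator_def of_bool_def)
qed

text \<open>With \<open>w = s z\<close> and \<open>R = (1 - |w|) / 2\<close>, every
  \<open>\<zeta>\<close> in \<open>ball w R\<close> satisfies \<open>R < 1 - |\<zeta>| < 3 R\<close>
  and \<open>|\<zeta> - z| < 3 R\<close>, so this disc lies in the region of the average at
  \<open>z\<close>. One average therefore dominates all \<open>s\<close> at once.\<close>

lemma higher_deriv_le_carleson_average: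
  assumes p: "0 < p"
  shows "\<exists>K>0. \<forall>G z s. G holomorphic_on unit_disc \<longrightarrow> norm z < 1 \<longrightarrow> s \<in> {0..1} \<longrightarrow>
     ennreal ((norm ((deriv ^^ n) G (of_real s * z)) * (1 - s * norm z) powr (1 / (2 * p) + n)) powr p)
       \<le> ennreal K * carleson_average p G z"
proof -
  define b where "b = 1 / (2 * p)"
  have b: "0 < b" "b * p = 1/2" using p by (auto simp: b_def)
  obtain K where K: "0 < K" "\<And>f a R. 0 < R \<Longrightarrow> f holomorphic_on ball a R \<Longrightarrow>
     ennreal ((norm ((deriv ^^ n) f a) * R ^ n) powr p * R\<^sup>2)
       \<le> ennreal K * (\<integral>\<^sup>+z. ennreal (norm (f z) powr p) * indicator (ball a R) z \<partial>lborel)"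
    using higher_deriv_powr_le_area_integral[OF p] by blast
  define c where "c = (2 powr (b + n)) powr p * 3 powr (3/2) * K"
  have c: "0 < c" using K by (simp add: c_def)
  have "ennreal ((norm ((deriv ^^ n) G (of_real s * z)) * (1 - s * norm z) powr (b + n)) powr p)
       \<le> ennreal c * carleson_average p G z"
    if G: "G holomorphic_on unit_disc" and z: "norm z < 1" and s: "s \<in> {0..1}" for G z s
  proof -
    define w where "w = of_real s * z"
    define R where "R = (1 - norm w) / 2"
    define N where "N = norm ((deriv ^^ n) G w)"
    have nw: "norm w = s * norm z" using s by (simp add: w_def norm_mult)
    have "norm w \<le> 1 * norm z" unfolding nw using s by (intro mult_right_mono) auto
    then have R: "0 < R" "norm w = 1 - 2 * R" using z by (auto simp: R_def field_simps)
    have zw: "dist z w \<le> 2 * R"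
    proof -
      have "z - w = of_real (1 - s) * z" by (simp add: w_def algebra_simps)
      then have "norm (z - w) = (1 - s) * norm z" using s by (simp only: norm_mult norm_of_real) simp
      then have "dist z w = norm z - norm w" by (simp add: dist_norm nw algebra_simps)
      then show ?thesis using z R by simp
    qed
    have sub: "norm \<zeta> < 1 \<and> 1 - norm \<zeta> \<le> 3 * R \<and> dist \<zeta> z \<le> 3 * (1 - norm \<zeta>)" if "\<zeta> \<in> ball w R" for \<zeta>
    proof -
      have "dist w \<zeta> < R" using that by simp
      moreover have "norm w - norm \<zeta> \<le> dist w \<zeta>" "norm \<zeta> - norm w \<le> dist w \<zeta>"
        using norm_triangle_ineq3[of w \<zeta>] by (auto simp: dist_norm)
      moreover have "dist \<zeta> z \<le> dist w \<zeta> + dist z w" using dist_triangle[of \<zeta> z w] by (simp add: dist_commute)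
      ultimately show ?thesis using R zw by auto
    qed
    have "ennreal ((N * R ^ n) powr p * R\<^sup>2) \<le> ennreal K * (\<integral>\<^sup>+\<zeta>. ennreal (norm (G \<zeta>) powr p) * indicator (ball w R) \<zeta> \<partial>lborel)"
      unfolding N_def using R sub by (intro K(2) holomorphic_on_subset[OF G]) auto
    also have "\<dots> \<le> ennreal K * (ennreal ((3 * R) powr (3/2)) * carleson_average p G z)"
    proof (intro mult_left_mono)
      have "(\<integral>\<^sup>+\<zeta>. ennreal (norm (G \<zeta>) powr p) * indicator (ball w R) \<zeta> \<partial>lborel)
         \<le> (\<integral>\<^sup>+\<zeta>. ennreal ((3 * R) powr (3/2)) * (ennreal (norm (G \<zeta>) powr p) * indicator unit_disc \<zeta>
     * (ennreal ((1 - norm \<zeta>) powr (-3/2)) * indicator {\<zeta>. dist \<zeta> z \<le> 3 * (1 - norm \<zeta>)} \<zeta>)) \<partial>lborel)"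
      proof (rule nn_integral_mono)
        fix \<zeta>
        show "ennreal (norm (G \<zeta>) powr p) * indicator (ball w R) \<zeta>
         \<le> ennreal ((3 * R) powr (3/2)) * (ennreal (norm (G \<zeta>) powr p) * indicator unit_disc \<zeta>
           * (ennreal ((1 - norm \<zeta>) powr (-3/2)) * indicator {\<zeta>. dist \<zeta> z \<le> 3 * (1 - norm \<zeta>)} \<zeta>))"
        proof (cases "\<zeta> \<in> ball w R")
          case True
          note * = sub[OF True]
          have "(1 - norm \<zeta>) powr (3/2) \<le> (3 * R) powr (3/2)"
            using * by (intro powr_mono2) auto
          then have "1 \<le> (3 * R) powr (3/2) * (1 - norm \<zeta>) powr (-3/2)"
            using * powr_minus_divide[of "1 - norm \<zeta>" "3/2"] by simp
          then have "norm (G \<zeta>) powr p * 1 \<le> norm (G \<zeta>) powr p * ((3 * R) powr (3/2) * (1 - norm \<zeta>) powr (-3/2))"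
            by (intro mult_left_mono) auto
          then have "ennreal (norm (G \<zeta>) powr p) \<le> ennreal ((3 * R) powr (3/2) * (norm (G \<zeta>) powr p * (1 - norm \<zeta>) powr (-3/2)))"
            by (intro ennreal_leI) (simp add: ac_simps)
          then show ?thesis using True * by (simp add: ennreal_mult)
        qed auto
      qed
      also have "\<dots> = ennreal ((3 * R) powr (3/2)) * carleson_average p G z"
        unfolding carleson_average_def
      proof (rule nn_integral_cmult)
        have [measurable]: "(\<lambda>\<zeta>. ennreal (norm (G \<zeta>) powr p) * indicator unit_disc \<zeta>) \<in> borel_measurable borel"
          using G by (intro borel_measurable_powr_indicator holomorphic_on_imp_continuous_on) auto
        show "(\<lambda>\<zeta>. ennreal (norm (G \<zeta>) powr p) * indicator unit_disc \<zeta>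
          * (ennreal ((1 - norm \<zeta>) powr (-3/2)) * indicator {\<zeta>. dist \<zeta> z \<le> 3 * (1 - norm \<zeta>)} \<zeta>)) \<in> borel_measurable lborel"
          by measurable
      qed
      finally show "(\<integral>\<^sup>+\<zeta>. ennreal (norm (G \<zeta>) powr p) * indicator (ball w R) \<zeta> \<partial>lborel) \<le> \<dots>" .
    qed auto
    finally have 1: "ennreal ((N * R ^ n) powr p * R\<^sup>2) \<le> ennreal K * (ennreal ((3 * R) powr (3/2)) * carleson_average p G z)" .
    have "(N * (1 - s * norm z) powr (b + n)) powr p = (2 powr (b + n)) powr p * ((N * R ^ n) powr p * (R powr b) powr p)"
    proof -
      have "1 - s * norm z = 2 * R" using R nw by simp
      moreover have "R powr (b + n) = R powr b * R ^ n" using R by (simp add: powr_add powr_realpow)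
      ultimately show ?thesis using R by (simp add: powr_mult N_def ac_simps)
    qed
    \<comment> \<open>Here \<open>b * p = 1/2\<close> enters: \<open>R^(1/2)\<close> splits into the
      area factor \<open>R^2\<close> and \<open>R^(-3/2)\<close>, which cancels the power of
      \<open>3 * R\<close> from the weight. The constant \<open>c\<close> is thus free of
      \<open>R\<close>.\<close>
    also have "(R powr b) powr p = R\<^sup>2 * R powr (-3/2)"
    proof -
      have "R powr (1/2) = R powr (2 + (-3/2))" by simp
      also have "\<dots> = R\<^sup>2 * R powr (-3/2)" using R by (subst powr_add) (simp add: powr_realpow)
      finally show ?thesis by (simp add: powr_powr b)
    qed
    also have "(2 powr (b + n)) powr p * ((N * R ^ n) powr p * (R\<^sup>2 * R powr (-3/2)))
        = (2 powr (b + n)) powr p * R powr (-3/2) * ((N * R ^ n) powr p * R\<^sup>2)" by simp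
    finally have "ennreal ((N * (1 - s * norm z) powr (b + n)) powr p)
        = ennreal ((2 powr (b + n)) powr p * R powr (-3/2)) * ennreal ((N * R ^ n) powr p * R\<^sup>2)"
      by (simp add: ennreal_mult)
    also have "\<dots> \<le> ennreal ((2 powr (b + n)) powr p * R powr (-3/2)) * (ennreal K * (ennreal ((3 * R) powr (3/2)) * carleson_average p G z))"
      using 1 by (intro mult_left_mono) auto
    also have "\<dots> = ennreal ((2 powr (b + n)) powr p * R powr (-3/2) * (K * (3 * R) powr (3/2))) * carleson_average p G z"
      using K(1) by (simp add: ennreal_mult ac_simps)
    also have "(2 powr (b + n)) powr p * R powr (-3/2) * (K * (3 * R) powr (3/2)) = c"
      using R powr_minus_divide[of R "3/2"] by (simp add: c_def powr_mult)
    finally show ?thesis by (simp add: N_def w_def)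
  qed
  then show ?thesis using c unfolding b_def by blast
qed

text \<open>After exchanging the integrals, the inner one over \<open>z\<close> is a Carleson box
  integral of order \<open>(1 - |\<zeta>|)^(3/2)\<close>, which cancels the weight of the
  average.\<close>

lemma nn_integral_carleson_average:
  assumes G: "G holomorphic_on unit_disc"
  shows "(\<integral>\<^sup>+z. ennreal ((1 - norm z) powr (-1/2)) * indicator unit_disc z * carleson_average p G z \<partial>lborel)
     \<le> ennreal (640 * pi) * (\<integral>\<^sup>+\<zeta>. ennreal (norm (G \<zeta>) powr p) * indicator unit_disc \<zeta> \<partial>lborel)"
proof -
  define a where "a z = ennreal ((1 - norm z) powr (-1/2)) * indicator unit_disc z" for z :: complex
  define H where "H \<zeta> = ennreal (norm (G \<zeta>) powr p) * indicator unit_disc \<zeta>" for \<zeta>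
  define E where "E z \<zeta> = (if dist \<zeta> z \<le> 3 * (1 - norm \<zeta>) then 1 else 0 :: ennreal)" for z \<zeta> :: complex
  have H[measurable]: "H \<in> borel_measurable borel" unfolding H_def
    using G by (intro borel_measurable_powr_indicator holomorphic_on_imp_continuous_on) auto
  have [measurable]: "(indicator unit_disc :: complex \<Rightarrow> ennreal) \<in> borel_measurable borel"
    by (intro borel_measurable_indicator) auto
  have a[measurable]: "a \<in> borel_measurable borel" unfolding a_def by measurable
  have E[measurable]: "(\<lambda>(z, \<zeta>). E z \<zeta>) \<in> borel_measurable (borel \<Otimes>\<^sub>M borel)"
    unfolding E_def by measurable
  let ?q = "\<lambda>z \<zeta>. a z * (H \<zeta> * (ennreal ((1 - norm \<zeta>) powr (-3/2)) * E z \<zeta>))"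
  have q: "(\<lambda>(z, \<zeta>). ?q z \<zeta>) \<in> borel_measurable (lborel \<Otimes>\<^sub>M lborel)" by measurable
  have "(\<integral>\<^sup>+z. a z * carleson_average p G z \<partial>lborel) = (\<integral>\<^sup>+z. (\<integral>\<^sup>+\<zeta>. ?q z \<zeta> \<partial>lborel) \<partial>lborel)"
  proof (rule nn_integral_cong)
    fix z
    have "(\<integral>\<^sup>+\<zeta>. ?q z \<zeta> \<partial>lborel) = a z * (\<integral>\<^sup>+\<zeta>. H \<zeta> * (ennreal ((1 - norm \<zeta>) powr (-3/2)) * E z \<zeta>) \<partial>lborel)"
      by (rule nn_integral_cmult) measurable
    then show "a z * carleson_average p G z = (\<integral>\<^sup>+\<zeta>. ?q z \<zeta> \<partial>lborel)"
      by (simp add: carleson_average_def H_def E_def indicator_def of_bool_def)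
  qed
  also have "\<dots> = (\<integral>\<^sup>+\<zeta>. (\<integral>\<^sup>+z. ?q z \<zeta> \<partial>lborel) \<partial>lborel)"
    using q by (rule lborel_pair.Fubini'[symmetric])
  also have "\<dots> \<le> (\<integral>\<^sup>+\<zeta>. ennreal (640 * pi) * H \<zeta> \<partial>lborel)"
  proof (rule nn_integral_mono)
    fix \<zeta> :: complex
    show "(\<integral>\<^sup>+z. ?q z \<zeta> \<partial>lborel) \<le> ennreal (640 * pi) * H \<zeta>"
    proof (cases "\<zeta> \<in> unit_disc")
      case True
      let ?c = "H \<zeta> * ennreal ((1 - norm \<zeta>) powr (-3/2))"
      have "(\<integral>\<^sup>+z. ?q z \<zeta> \<partial>lborel) = (\<integral>\<^sup>+z. ?c * (a z * E z \<zeta>) \<partial>lborel)"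
        by (simp add: ac_simps)
      also have "\<dots> = ?c * (\<integral>\<^sup>+z. a z * E z \<zeta> \<partial>lborel)"
        by (rule nn_integral_cmult) measurable
      also have "(\<integral>\<^sup>+z. a z * E z \<zeta> \<partial>lborel)
          = (\<integral>\<^sup>+z. ennreal ((1 - norm z) powr (-1/2)) * indicator (ball 0 1 \<inter> cball \<zeta> (3 * (1 - norm \<zeta>))) z \<partial>lborel)"
        by (rule nn_integral_cong) (auto simp: a_def E_def indicator_def)
      also have "?c * \<dots> \<le> ?c * ennreal (640 * pi * (1 - norm \<zeta>) powr (3/2))"
        using True by (intro mult_left_mono nn_integral_carleson_box) auto
      also have "\<dots> = ennreal (640 * pi) * H \<zeta>"
      proof -
        have "ennreal ((1 - norm \<zeta>) powr (-3/2)) * ennreal (640 * pi * (1 - norm \<zeta>) powr (3/2)) = ennreal (640 * pi)"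
          using True powr_minus_divide[of "1 - norm \<zeta>" "3/2"] by (simp flip: ennreal_mult)
        then show ?thesis by (metis mult.assoc mult.commute)
      qed
      finally show ?thesis .
    qed (simp add: H_def)
  qed
  also have "\<dots> = ennreal (640 * pi) * (\<integral>\<^sup>+\<zeta>. H \<zeta> \<partial>lborel)"
    by (rule nn_integral_cmult) measurable
  finally show ?thesis by (simp add: a_def H_def)
qed

section \<open>Membership of solutions in the Bergman space\<close>

text \<open>The pointwise bound is used with \<open>b = 1 / (2 * p)\<close>, so that
  \<open>1 / (4 * p) = b / 2\<close>, and with \<open>\<Lambda>^p\<close> a multiple of the Carleson
  average \<open>L\<close> of \<open>I^n F\<close>. Then \<open>|f|^p\<close> is at most a constant
  times \<open>(1 + L) (1 - |z|)^(-1/2)\<close>, which is integrable.\<close>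

lemma solution_in_bergman:
  assumes p: "0 < p" and n: "n \<ge> 1" and \<rho>: "0 \<le> \<rho>" "\<rho> < 1"
    and F: "F holomorphic_on unit_disc" and G: "(intop ^^ n) F \<in> bergman p"
    and g: "\<And>k z. k < n \<Longrightarrow> \<rho> \<le> norm z \<Longrightarrow> norm z < 1 \<Longrightarrow>
               norm (g k z) \<le> 1 / (4 * p) * (1 - norm z) powr (- real (n - k))"
    and sol: "is_solution n g F f"
  shows "f \<in> bergman p"
proof -
  define b where "b = 1 / (2 * p)"
  have b: "0 < b" "b * p = 1/2" using p by (auto simp: b_def)
  let ?G = "(intop ^^ n) F"
  define L where "L = carleson_average p ?G"
  define a where "a z = ennreal ((1 - norm z) powr (-1/2)) * indicator unit_disc z" for z :: complex
  have holG: "?G holomorphic_on unit_disc" and finG: "(\<integral>\<^sup>+\<zeta>. ennreal (norm (?G \<zeta>) powr p) * indicator unit_disc \<zeta> \<partial>lborel) < \<infinity>"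
    using G by (auto simp: bergman_def mult.commute)
  obtain K where K: "0 < K" "\<And>z s. norm z < 1 \<Longrightarrow> s \<in> {0..1} \<Longrightarrow>
     ennreal ((norm (F (of_real s * z)) * (1 - s * norm z) powr (b + n)) powr p) \<le> ennreal K * L z"
  proof -
    obtain K where K: "0 < K" "\<And>G z s. G holomorphic_on unit_disc \<Longrightarrow> norm z < 1 \<Longrightarrow> s \<in> {0..1} \<Longrightarrow>
     ennreal ((norm ((deriv ^^ n) G (of_real s * z)) * (1 - s * norm z) powr (b + n)) powr p) \<le> ennreal K * carleson_average p G z"
      using higher_deriv_le_carleson_average[OF p, of n] unfolding b_def by blast
    show thesis
    proof (rule that[OF K(1)])
      fix z :: complex and s :: real
      assume z: "norm z < 1" and s: "s \<in> {0..1}"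
      have "norm (of_real s * z) \<le> 1 * norm z"
        using s unfolding norm_mult by (intro mult_right_mono) auto
      then have "of_real s * z \<in> unit_disc" using z by simp
      then show "ennreal ((norm (F (of_real s * z)) * (1 - s * norm z) powr (b + n)) powr p) \<le> ennreal K * L z"
        using K(2)[OF holG z s] higher_deriv_funpow_intop[OF F] by (simp add: L_def)
    qed
  qed
  have "norm (g k z) \<le> b / 2 * (1 - norm z) powr (- real (n - k))"
    if "k < n" "\<rho> \<le> norm z" "norm z < 1" for k z
    using g[OF that] by (simp add: b_def)
  then obtain C where C: "0 < C" "\<And>z \<Lambda>. norm z < 1 \<Longrightarrow> 0 \<le> \<Lambda> \<Longrightarrow>
      (\<And>s. s\<in>{0..1} \<Longrightarrow> norm (F (of_real s * z)) \<le> \<Lambda> * (1 - s * norm z) powr (-(b + n))) \<Longrightarrow>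
      norm (f z) \<le> C * (1 + \<Lambda>) * (1 - norm z) powr (-b)"
    using solution_pointwise_bound[OF b(1) n \<rho> _ sol] by blast
  define c where "c = (2 * C) powr p * (1 + K)"
  have c: "0 < c" using C(1) K(1) by (auto simp: c_def intro!: mult_pos_pos)
  have pointwise: "indicator unit_disc z * ennreal (norm (f z) powr p) \<le> ennreal c * (a z + a z * L z)" for z
  proof (cases "z \<in> unit_disc")
    case True
    then have z: "norm z < 1" by simp
    show ?thesis
    proof (cases "L z")
      \<comment> \<open>Since \<open>a z\<close> and \<open>c\<close> are positive, the right side
        is infinite here.\<close>
      case top
      then show ?thesis using True c z by (simp add: a_def ennreal_mult_top ennreal_mult_eq_top_iff)
    next
      case (real l)
      define \<Lambda> where "\<Lambda> = (K * l) powr (1 / p)"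
      have "norm (f z) \<le> C * (1 + \<Lambda>) * (1 - norm z) powr (-b)"
      proof (rule C(2)[OF z])
        fix s :: real assume s: "s \<in> {0..1}"
        have "s * norm z \<le> 1 * norm z" using s by (intro mult_right_mono) auto
        then have sz: "0 < 1 - s * norm z" using z by simp
        let ?X = "norm (F (of_real s * z)) * (1 - s * norm z) powr (b + n)"
        have "ennreal (?X powr p) \<le> ennreal (K * l)"
          using K(2)[OF z s] K(1) real by (simp add: ennreal_mult)
        then have "?X powr p \<le> K * l" using K(1) real(1) by (subst (asm) ennreal_le_iff) auto
        then have "(?X powr p) powr (1 / p) \<le> \<Lambda>"
          unfolding \<Lambda>_def using p by (intro powr_mono2) auto
        then have "?X \<le> \<Lambda>" using p by (simp add: powr_powr)
        then show "norm (F (of_real s * z)) \<le> \<Lambda> * (1 - s * norm z) powr (-(b + n))"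
          using sz unfolding powr_minus[of _ "b + n"] by (simp add: field_simps)
      qed (simp add: \<Lambda>_def)
      \<comment> \<open>Replacing \<open>1 + \<Lambda>\<close> by \<open>2 * max 1 \<Lambda>\<close>
        makes the \<open>p\<close>-th power easy to split for \<open>p\<close> below and above 1
        alike.\<close>
      also have "\<dots> \<le> C * (2 * max 1 \<Lambda>) * (1 - norm z) powr (-b)"
        using C(1) by (intro mult_right_mono mult_left_mono) auto
      finally have "norm (f z) powr p \<le> (2 * C * max 1 \<Lambda> * (1 - norm z) powr (-b)) powr p"
        using p by (intro powr_mono2) (auto simp: ac_simps)
      also have "\<dots> = (2 * C) powr p * (max 1 \<Lambda>) powr p * (1 - norm z) powr (-1/2)"
      proof -
        have "((1 - norm z) powr (-b)) powr p = (1 - norm z) powr (-1/2)"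
          by (simp only: powr_powr minus_mult_left[symmetric] b(2)) simp
        then show ?thesis using C(1) by (simp add: powr_mult)
      qed
      also have "\<dots> \<le> (2 * C) powr p * ((1 + K) * (1 + l)) * (1 - norm z) powr (-1/2)"
      proof (intro mult_right_mono mult_left_mono)
        have "(max 1 \<Lambda>) powr p \<le> 1 + K * l"
          using p K(1) real(1) by (auto simp: max_def \<Lambda>_def powr_powr)
        also have "\<dots> \<le> (1 + K) * (1 + l)" using K(1) real(1) by (simp add: algebra_simps)
        finally show "(max 1 \<Lambda>) powr p \<le> (1 + K) * (1 + l)" .
      qed auto
      finally have "norm (f z) powr p \<le> c * ((1 - norm z) powr (-1/2) + (1 - norm z) powr (-1/2) * l)"
        by (simp add: c_def algebra_simps)
      from ennreal_leI[OF this] show ?thesis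
        using True c real by (simp add: a_def ennreal_mult)
    qed
  qed simp
  have [measurable]: "(indicator unit_disc :: complex \<Rightarrow> ennreal) \<in> borel_measurable borel"
    by (intro borel_measurable_indicator) auto
  have [measurable]: "a \<in> borel_measurable borel" "L \<in> borel_measurable borel"
    unfolding a_def L_def by (measurable, rule borel_measurable_carleson_average[OF holG])
  have "(\<integral>\<^sup>+z. indicator unit_disc z * ennreal (norm (f z) powr p) \<partial>lborel)
      \<le> (\<integral>\<^sup>+z. ennreal c * (a z + a z * L z) \<partial>lborel)"
    using pointwise by (rule nn_integral_mono)
  also have "\<dots> = ennreal c * ((\<integral>\<^sup>+z. a z \<partial>lborel) + (\<integral>\<^sup>+z. a z * L z \<partial>lborel))"
    by (simp add: nn_integral_cmult nn_integral_add)
  also have "\<dots> < \<infinity>"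
  proof -
    \<comment> \<open>The integral of \<open>a\<close> is the Carleson box integral at
      \<open>\<zeta> = 0\<close>, where \<open>d = 1\<close> and the box is the whole disc.\<close>
    have "unit_disc \<subseteq> cball (0::complex) 3" by auto
    then have "unit_disc \<inter> cball (0::complex) 3 = unit_disc" by blast
    then have "(\<integral>\<^sup>+z. a z \<partial>lborel) \<le> ennreal (640 * pi)"
      using nn_integral_carleson_box[of 0] by (simp add: a_def)
    then have "(\<integral>\<^sup>+z. a z \<partial>lborel) < \<infinity>" using le_less_trans by fastforce
    moreover have "(\<integral>\<^sup>+z. a z * L z \<partial>lborel) < \<infinity>"
    proof (rule le_less_trans)
      show "(\<integral>\<^sup>+z. a z * L z \<partial>lborel) \<le> ennreal (640 * pi) * (\<integral>\<^sup>+\<zeta>. ennreal (norm (?G \<zeta>) powr p) * indicator unit_disc \<zeta> \<partial>lborel)"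
        unfolding a_def L_def by (rule nn_integral_carleson_average[OF holG])
      show "\<dots> < \<infinity>" using finG by (simp add: ennreal_mult_less_top)
    qed
    ultimately show ?thesis by (simp add: ennreal_mult_less_top)
  qed
  finally show ?thesis using sol by (simp add: bergman_def is_solution_def)
qed

text \<open>Because \<open>1 - x \<le> 1 - x\<^sup>2\<close> on the unit interval, passing to the
  weight in \<open>1 - x\<close> costs no constant.\<close>

lemma one_minus_powr_le:
  fixes g :: complex
  assumes "norm g * (1 - x\<^sup>2) powr real m \<le> A" "0 \<le> x" "x < 1"
  shows "norm g \<le> A * (1 - x) powr (- real m)"
proof -
  have "x\<^sup>2 \<le> x" using assms by (simp add: power2_eq_square mult_left_le)
  then have "norm g * (1 - x) powr real m \<le> norm g * (1 - x\<^sup>2) powr real m"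
    using assms by (intro mult_left_mono powr_mono2) auto
  also note assms(1)
  finally show ?thesis using assms unfolding powr_minus[of _ "real m"] by (simp add: field_simps)
qed

theorem theorem1p7:
  fixes p :: real
  assumes "0 < p"
  shows "(\<exists>A>0. \<forall>(n::nat) F g f.
            n \<ge> 1 \<longrightarrow> F holomorphic_on unit_disc \<longrightarrow> (intop ^^ n) F \<in> bergman p \<longrightarrow>
            (\<forall>k<n. g k \<in> growth_space (real (n - k))) \<longrightarrow>
            (\<forall>k<n. growth_norm (real (n - k)) (g k) < A) \<longrightarrow>
            is_solution n g F f \<longrightarrow> f \<in> bergman p)
       \<and> (\<forall>(n::nat) F g f.
            n \<ge> 1 \<longrightarrow> F holomorphic_on unit_disc \<longrightarrow> (intop ^^ n) F \<in> bergman p \<longrightarrow>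
            (\<forall>k<n. g k \<in> little_growth_space (real (n - k))) \<longrightarrow>
            is_solution n g F f \<longrightarrow> f \<in> bergman p)"
proof (intro conjI allI impI)
  have A: "0 < 1 / (4 * p)" using assms by simp
  show "\<exists>A>0. \<forall>(n::nat) F g f.
            n \<ge> 1 \<longrightarrow> F holomorphic_on unit_disc \<longrightarrow> (intop ^^ n) F \<in> bergman p \<longrightarrow>
            (\<forall>k<n. g k \<in> growth_space (real (n - k))) \<longrightarrow>
            (\<forall>k<n. growth_norm (real (n - k)) (g k) < A) \<longrightarrow>
            is_solution n g F f \<longrightarrow> f \<in> bergman p"
  \<comment> \<open>This is \<open>b / 2\<close> for \<open>b = 1 / (2 * p)\<close>, the same value
    for all orders \<open>n\<close>.\<close>
  proof (intro exI[of _ "1 / (4 * p)"] conjI A allI impI)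
    fix n :: nat and F f :: "complex \<Rightarrow> complex" and g :: "nat \<Rightarrow> complex \<Rightarrow> complex"
    assume n: "n \<ge> 1" "F holomorphic_on unit_disc" "(intop ^^ n) F \<in> bergman p"
      and g: "\<forall>k<n. g k \<in> growth_space (real (n - k))" "\<forall>k<n. growth_norm (real (n - k)) (g k) < 1 / (4 * p)"
      and sol: "is_solution n g F f"
    show "f \<in> bergman p"
    proof (rule solution_in_bergman[of p n 0, OF assms n(1) _ _ n(2,3) _ sol])
      fix k z assume k: "k < n" and z: "norm (z::complex) < 1"
      \<comment> \<open>Membership in the growth space makes the real supremum in
        \<open>growth_norm\<close> a genuine upper bound. The estimate then holds on the whole disc,
        so \<open>\<rho> = 0\<close> works.\<close>
      have "bdd_above ((\<lambda>z. norm (g k z) * (1 - (norm z)\<^sup>2) powr real (n - k)) ` unit_disc)"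
        using g(1) k by (auto simp: growth_space_def bdd_above_def)
      then have "norm (g k z) * (1 - (norm z)\<^sup>2) powr real (n - k) \<le> growth_norm (real (n - k)) (g k)"
        unfolding growth_norm_def using z by (intro cSUP_upper) auto
      then have "norm (g k z) * (1 - (norm z)\<^sup>2) powr real (n - k) \<le> 1 / (4 * p)"
        using g(2) k by fastforce
      then show "norm (g k z) \<le> 1 / (4 * p) * (1 - norm z) powr (- real (n - k))"
        by (rule one_minus_powr_le) (use z in auto)
    qed auto
  qed
  fix n :: nat and F f :: "complex \<Rightarrow> complex" and g :: "nat \<Rightarrow> complex \<Rightarrow> complex"
  assume n: "n \<ge> 1" "F holomorphic_on unit_disc" "(intop ^^ n) F \<in> bergman p"
    and g: "\<forall>k<n. g k \<in> little_growth_space (real (n - k))"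
    and sol: "is_solution n g F f"
  have "\<forall>k<n. \<exists>r<1. \<forall>z. r < norm z \<and> norm z < 1 \<longrightarrow>
          norm (g k z) * (1 - (norm z)\<^sup>2) powr real (n - k) \<le> 1 / (4 * p)"
    using g A by (auto simp: little_growth_space_def)
  then obtain r where r: "\<And>k. k < n \<Longrightarrow> r k < 1" "\<And>k z. k < n \<Longrightarrow> r k < norm z \<Longrightarrow> norm z < 1 \<Longrightarrow>
          norm (g k z) * (1 - (norm z)\<^sup>2) powr real (n - k) \<le> 1 / (4 * p)"
    by metis
  \<comment> \<open>Inserting 0 keeps \<open>m\<close> nonnegative, as some \<open>r k\<close> may
    be negative.\<close>
  define m where "m = Max (insert 0 (r ` {..<n}))"
  have m: "0 \<le> m" "m < 1" "\<And>k. k < n \<Longrightarrow> r k \<le> m"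
    using r(1) by (auto simp: m_def)
  show "f \<in> bergman p"
  proof (rule solution_in_bergman[OF assms n(1) _ _ n(2,3) _ sol])
    \<comment> \<open>The midpoint of \<open>m\<close> and 1 is used because the bounds on the
      coefficients hold strictly beyond radius \<open>r k\<close>, while the annulus includes its
      inner circle.\<close>
    show "0 \<le> (m + 1) / 2" "(m + 1) / 2 < 1" using m by auto
    fix k z assume k: "k < n" and z: "(m + 1) / 2 \<le> norm (z::complex)" "norm z < 1"
    have "r k < norm z" using m(2) m(3)[OF k] z by simp
    then show "norm (g k z) \<le> 1 / (4 * p) * (1 - norm z) powr (- real (n - k))"
      using r(2)[OF k _ z(2)] z by (intro one_minus_powr_le) auto
  qed
qed

end
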